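(* There exists a constant $c>0$ such that for each sufficiently large $n\in\mathbb{N}$ there is a contraction $X_n\in\mathbb{M}_{3n}$ satisfying $\operatorname{mal}(X_n)\geq c$.
   Context: $\mathbb{M}_m$ denotes the complex $m\times m$ matrices, $[X,B]=XB-BX$, $\|B\|_2=\operatorname{tr}(B^*B)^{1/2}$ is the (unnormalized) Hilbert--Schmidt norm, and $\tau(B)=\frac1m\operatorname{tr}(B)$ is the normalized trace. A contraction is a matrix of operator norm (largest singular value) at most $1$. A matrix $X\in\mathbb{M}_m$ is $\kappa$-malnormal if $\|[X,B]\|_2\geq\kappa\,\|B-\tau(B)I\|_2$ for all self-adjoint $B\in\mathbb{M}_m$, and $\operatorname{mal}(X)$ is the largest constant $\kappa$ for which $X$ is $\kappa$-malnormal. *)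

theory Defs
  imports "Jordan_Normal_Form.Schur_Decomposition" Complex_Main
begin

definition mat_trace :: "complex mat \<Rightarrow> complex" where
  "mat_trace A = (\<Sum>i<dim_row A. A $$ (i, i))"

definition normalized_trace :: "complex mat \<Rightarrow> complex" where
  "normalized_trace A = mat_trace A / of_nat (dim_row A)"

text \<open>The trace of \<open>A\<^sup>* A\<close> is a nonnegative real number, so taking its real part loses nothing.\<close>

definition hs_norm :: "complex mat \<Rightarrow> real" where
  "hs_norm A = sqrt (Re (mat_trace (mat_adjoint A * A)))"

definition l2_norm :: "complex vec \<Rightarrow> real" where
  "l2_norm v = sqrt (Re (v \<bullet>c v))"

definition op_norm :: "complex mat \<Rightarrow> real" where
  "op_norm A = (SUP v\<in>{v \<in> carrier_vec (dim_col A). l2_norm v \<le> 1}. l2_norm (A *\<^sub>v v))"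

definition contraction :: "complex mat \<Rightarrow> bool" where
  "contraction A \<longleftrightarrow> op_norm A \<le> 1"

definition commutator :: "complex mat \<Rightarrow> complex mat \<Rightarrow> complex mat" where
  "commutator A B = A * B - B * A"

definition self_adjoint :: "complex mat \<Rightarrow> bool" where
  "self_adjoint B \<longleftrightarrow> mat_adjoint B = B"

definition malnormal :: "real \<Rightarrow> complex mat \<Rightarrow> bool" where
  "malnormal \<kappa> X \<longleftrightarrow>
    (\<forall>B \<in> carrier_mat (dim_row X) (dim_row X). self_adjoint B \<longrightarrow>
       hs_norm (commutator X B) \<ge>
         \<kappa> * hs_norm (B - normalized_trace B \<cdot>\<^sub>m 1\<^sub>m (dim_row X)))"

text \<open>For square \<open>X\<close> of dimension at least 2 the greatest element exists (lemma
  \<open>malnormal_mal\<close> below). In dimension at most 1 every \<open>\<kappa>\<close> qualifies and the value of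
  \<open>mal X\<close> is unspecified.\<close>

definition mal :: "complex mat \<Rightarrow> real" where
  "mal X = (GREATEST \<kappa>. malnormal \<kappa> X)"

lemma mat_adjoint_index:
  assumes "A \<in> carrier_mat r c" "i < c" "j < r"
  shows "mat_adjoint A $$ (i, j) = cnj (A $$ (j, i))"
  using assms by (simp add: mat_adjoint_def mat_of_rows_def)

lemma mat_adjoint_carrier:
  assumes "A \<in> carrier_mat r c"
  shows "mat_adjoint A \<in> carrier_mat c r"
  using assms by (auto simp: mat_adjoint_def mat_of_rows_def)

lemma hs_norm_eq:
  assumes A: "A \<in> carrier_mat r c"
  shows "hs_norm A = sqrt (\<Sum>j<c. \<Sum>i<r. (cmod (A $$ (i, j)))\<^sup>2)"
proof -
  have d: "dim_row (mat_adjoint A) = c" "dim_col (mat_adjoint A) = r"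
    using mat_adjoint_carrier[OF A] by auto
  have "(mat_adjoint A * A) $$ (j, j) = (\<Sum>i<r. of_real ((cmod (A $$ (i, j)))\<^sup>2))" if "j < c" for j
    using that A d
    by (auto simp: scalar_prod_def mat_adjoint_index[OF A] complex_norm_square mult.commute lessThan_atLeast0
        simp del: of_real_power intro!: sum.cong)
  then have "Re (mat_trace (mat_adjoint A * A)) = (\<Sum>j<c. \<Sum>i<r. (cmod (A $$ (i, j)))\<^sup>2)"
    using d by (simp add: mat_trace_def del: of_real_power)
  then show ?thesis by (simp add: hs_norm_def)
qed

lemma hs_norm_nonneg:
  assumes "A \<in> carrier_mat r c"
  shows "hs_norm A \<ge> 0"
  unfolding hs_norm_eq[OF assms] by (intro real_sqrt_ge_zero sum_nonneg) auto

lemma malnormal_mal: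
  assumes X: "X \<in> carrier_mat m m" and m: "m \<ge> 2"
  shows "malnormal (mal X) X" and "malnormal \<kappa> X \<Longrightarrow> \<kappa> \<le> mal X"
proof -
  define N where "N B = hs_norm (B - normalized_trace B \<cdot>\<^sub>m 1\<^sub>m m)" for B
  define L where "L B = hs_norm (commutator X B)" for B
  define S where "S = {\<kappa>. malnormal \<kappa> X}"
  have mal: "malnormal k X \<longleftrightarrow> (\<forall>B\<in>carrier_mat m m. self_adjoint B \<longrightarrow> k * N B \<le> L B)" for k
    using X by (auto simp: malnormal_def N_def L_def)
  have L0: "L B \<ge> 0" if "B \<in> carrier_mat m m" for B
    unfolding L_def commutator_def using that X
    by (intro hs_norm_nonneg[of _ m m]) auto
  have N0: "N B \<ge> 0" if "B \<in> carrier_mat m m" for B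
    unfolding N_def using that by (intro hs_norm_nonneg[of _ m m]) auto
  have "malnormal 0 X" using L0 mal by auto
  then have ne: "S \<noteq> {}" by (auto simp: S_def)
  define E :: "complex mat" where
    "E = mat m m (\<lambda>(i, j). if i = 0 \<and> j = 0 then 1 else 0)"
  have E: "E \<in> carrier_mat m m" by (simp add: E_def)
  have Es: "self_adjoint E"
    unfolding self_adjoint_def
  proof (rule eq_matI)
    fix i j assume "i < dim_row E" "j < dim_col E"
    then have ij: "i < m" "j < m" using E by auto
    show "mat_adjoint E $$ (i, j) = E $$ (i, j)"
      unfolding mat_adjoint_index[OF E ij] using ij by (auto simp: E_def)
  qed (use E mat_adjoint_carrier[OF E] in auto)
  have "mat_trace E = (\<Sum>i<m. if i = 0 then 1 else 0)"
    unfolding mat_trace_def by (intro sum.cong) (auto simp: E_def)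
  then have "mat_trace E = 1" using m by simp
  then have tE: "normalized_trace E = 1 / of_nat m" by (simp add: normalized_trace_def E_def)
  define D where "D = E - normalized_trace E \<cdot>\<^sub>m 1\<^sub>m m"
  have D: "D \<in> carrier_mat m m" unfolding D_def using E by auto
  have D1: "cmod (D $$ (1, 1)) > 0"
    unfolding D_def tE using m E by (auto simp: E_def norm_divide)
  have "0 < (\<Sum>j<m. \<Sum>i<m. (cmod (D $$ (i, j)))\<^sup>2)"
    using m D1 by (intro sum_pos2[of _ 1] sum_nonneg) auto
  then have NE: "N E > 0" unfolding N_def D_def[symmetric] hs_norm_eq[OF D] by simp
  have bdd: "bdd_above S"
  proof (rule bdd_aboveI)
    fix k assume "k \<in> S"
    then have "k * N E \<le> L E" using mal E Es by (auto simp: S_def)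
    then show "k \<le> L E / N E" using NE by (simp add: field_simps)
  qed
  have "malnormal (Sup S) X"
    unfolding mal
  proof (intro ballI impI)
    fix B assume B: "B \<in> carrier_mat m m" and s: "self_adjoint B"
    show "Sup S * N B \<le> L B"
    proof (cases "N B = 0")
      case True
      then show ?thesis using L0[OF B] by simp
    next
      case False
      then have p: "N B > 0" using N0[OF B] by simp
      have "Sup S \<le> L B / N B"
        using p mal B s by (intro cSup_least[OF ne]) (auto simp: S_def field_simps)
      then show ?thesis using p by (simp add: field_simps)
    qed
  qed
  moreover have le: "k \<le> Sup S" if "malnormal k X" for k
    using that bdd by (intro cSup_upper) (auto simp: S_def)
  ultimately have eq: "mal X = Sup S" and g: "malnormal (Sup S) X"
    unfolding mal_def by (auto intro!: Greatest_equality)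
  show "malnormal (mal X) X" using g eq by simp
  show "\<kappa> \<le> mal X" if "malnormal \<kappa> X" using le[OF that] eq by simp
qed

end

theory Submission
  imports Defs
begin

text \<open>
  The matrix \<open>X\<close> is built from three unitaries of size \<open>n\<close>: the clock \<open>Z\<close> (diagonal, entries the \<open>n\<close>-th
  roots of unity), a diagonal quadratic chirp \<open>D\<close> and the Fourier matrix \<open>F\<close>. Up to a scalar,
  \<open>X\<close> has diagonal blocks \<open>Z\<close>, \<open>4 + D\<close>, \<open>8\<close> and skew-Hermitian off-diagonal blocks \<open>\<i>I\<close>,
  \<open>\<i>I\<close> and \<open>\<i>F\<close>.
  If a self-adjoint \<open>B\<close> nearly commutes with \<open>X\<close>, it nearly commutes with the diagonal matrix \<open>X + X\<^sup>*\<close>,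
  whose blocks have separated spectra, so \<open>B\<close> is nearly block diagonal. The
  off-diagonal blocks of \<open>X\<close> then force the diagonal blocks of \<open>B\<close> to be nearly equal, and their common
  value nearly commutes with \<open>Z\<close>, \<open>D\<close> and \<open>F\<close>.

  It remains to see that such a matrix is nearly scalar. Conjugation by the three unitaries acts on the
  coefficients with respect to the Weyl basis, indexed by pairs \<open>(k, l)\<close> modulo \<open>n\<close>: up to phases, \<open>Z\<close>
  multiplies by a power of the root of unity, \<open>D\<close> acts by the shear \<open>(k, l + k)\<close>
  and \<open>F\<close> by the rotation \<open>(-l, k)\<close>. Near-invariance under \<open>Z\<close> and \<open>F\<close> confines the mass to a small box
  around the origin, where no reduction modulo \<open>n\<close> interferes, and a ping-pong argument on quadrants shows that
  only the origin is nearly invariant under the shear and the rotation.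
\<close>

section \<open>Shears and rotations of the integer lattice\<close>

text \<open>Mass is transported along \<open>\<phi>\<close> with a small relative loss. The weight
  48 is tuned to the ping-pong argument below, which accumulates 24 such losses and hence only half
  of the total mass.\<close>

lemma sum_squares_le_image:
  fixes g :: "'a \<Rightarrow> real"
  assumes "finite Q" "E \<subseteq> Q" "inj_on \<phi> E" "\<phi> ` E \<subseteq> Q"
    and A: "(\<Sum>p\<in>E. (g (\<phi> p) - g p)\<^sup>2) \<le> A"
  shows "(\<Sum>p\<in>E. (g p)\<^sup>2) \<le> (\<Sum>p\<in>\<phi> ` E. (g p)\<^sup>2) + (\<Sum>p\<in>Q. (g p)\<^sup>2) / 48 + 49 * A"
proof -
  have "(g p)\<^sup>2 \<le> (g (\<phi> p))\<^sup>2 + (g (\<phi> p))\<^sup>2 / 48 + 49 * (g (\<phi> p) - g p)\<^sup>2" for p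
  proof -
    \<comment> \<open>Expanding this square is the weighted Cauchy inequality with weights 1/48 and
      48.\<close>
    have "0 \<le> (g (\<phi> p) + 48 * (g (\<phi> p) - g p))\<^sup>2 / 48"
      by simp
    then show ?thesis
      by (simp add: power2_eq_square algebra_simps)
  qed
  then have "(\<Sum>p\<in>E. (g p)\<^sup>2)
      \<le> (\<Sum>p\<in>E. (g (\<phi> p))\<^sup>2 + (g (\<phi> p))\<^sup>2 / 48 + 49 * (g (\<phi> p) - g p)\<^sup>2)"
    by (intro sum_mono)
  also have "\<dots> = (\<Sum>p\<in>\<phi> ` E. (g p)\<^sup>2) + (\<Sum>p\<in>\<phi> ` E. (g p)\<^sup>2) / 48
      + 49 * (\<Sum>p\<in>E. (g (\<phi> p) - g p)\<^sup>2)"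
    unfolding sum.distrib using assms(3)
    by (simp add: sum.reindex sum_distrib_left sum_divide_distrib o_def)
  also have "\<dots> \<le> (\<Sum>p\<in>\<phi> ` E. (g p)\<^sup>2) + (\<Sum>p\<in>Q. (g p)\<^sup>2) / 48 + 49 * A"
    using A sum_mono2[OF assms(1,4), of "\<lambda>p. (g p)\<^sup>2"] by simp
  finally show ?thesis .
qed

text \<open>Ping-pong: \<open>far\<close> and the rotation confine the mass to a smaller box, from
  which one shear stays inside \<open>Q\<close>. In that box the shears empty the region nearer the
  first axis, the rotation then empties the region nearer the second, and one more shear moves the
  diagonals into a region known to be light. Only the origin is left, and \<open>g\<close> vanishes
  there.\<close>

lemma shear_rotation_gap:
  fixes g :: "int \<times> int \<Rightarrow> real" and h r :: int
  defines "Q \<equiv> {-h..h} \<times> {-h..h}"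
  assumes r: "0 \<le> r" "2 * r \<le> h" and g0: "g (0, 0) = 0"
    and far: "(\<Sum>p\<in>{p\<in>Q. r < \<bar>fst p\<bar>}. (g p)\<^sup>2) \<le> A"
    and shear: "(\<Sum>p\<in>Q. (g (fst p, snd p + fst p) - g p)\<^sup>2) \<le> A"
    and rot: "(\<Sum>p\<in>Q. (g (- snd p, fst p) - g p)\<^sup>2) \<le> A"
  shows "(\<Sum>p\<in>Q. (g p)\<^sup>2) \<le> 2396 * A"
proof -
  define m where "m E = (\<Sum>p\<in>E. (g p)\<^sup>2)" for E
  define T where "T p = (fst p, snd p + fst p)" for p :: "int \<times> int"
  define T' where "T' p = (fst p, snd p - fst p)" for p :: "int \<times> int"
  define R where "R p = (- snd p, fst p)" for p :: "int \<times> int"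
  \<comment> \<open>The loss of a single move by the shear, its inverse or the rotation.\<close>
  define \<delta> where "\<delta> = m Q / 48 + 49 * A"
  have fin: "finite Q" by (simp add: Q_def)
  have mono: "m E \<le> m E'" if "E \<subseteq> E'" "E' \<subseteq> Q" for E E'
    unfolding m_def using that finite_subset[OF _ fin] by (intro sum_mono2) auto
  have un: "m (E \<union> E') \<le> m E + m E'" if "E \<subseteq> Q" "E' \<subseteq> Q" for E E'
  proof -
    have "finite E" "finite E'" using that finite_subset[OF _ fin] by auto
    then have "m E + m E' = m (E \<union> E') + m (E \<inter> E')"
      unfolding m_def by (simp add: sum.union_inter)
    moreover have "m (E \<inter> E') \<ge> 0" unfolding m_def by (intro sum_nonneg) auto
    ultimately show ?thesis by simp
  qed
  have inj: "inj_on T E" "inj_on T' E" "inj_on R E" for E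
    by (auto simp: inj_on_def T_def T'_def R_def)
  have mT: "m E \<le> m F + \<delta>" if "E \<subseteq> Q" "T ` E \<subseteq> F" "F \<subseteq> Q" for E F
  proof -
    have "(\<Sum>p\<in>E. (g (T p) - g p)\<^sup>2) \<le> (\<Sum>p\<in>Q. (g (T p) - g p)\<^sup>2)"
      using that fin by (intro sum_mono2) auto
    then have "(\<Sum>p\<in>E. (g (T p) - g p)\<^sup>2) \<le> A"
      using shear by (simp add: T_def)
    from sum_squares_le_image[OF fin that(1) inj(1) order_trans[OF that(2,3)] this] mono[OF that(2,3)]
    show ?thesis unfolding \<delta>_def m_def by simp
  qed
  have mR: "m E \<le> m F + \<delta>" if "E \<subseteq> Q" "R ` E \<subseteq> F" "F \<subseteq> Q" for E F
  proof -
    have "(\<Sum>p\<in>E. (g (R p) - g p)\<^sup>2) \<le> (\<Sum>p\<in>Q. (g (R p) - g p)\<^sup>2)"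
      using that fin by (intro sum_mono2) auto
    then have "(\<Sum>p\<in>E. (g (R p) - g p)\<^sup>2) \<le> A"
      using rot by (simp add: R_def)
    from sum_squares_le_image[OF fin that(1) inj(3) order_trans[OF that(2,3)] this] mono[OF that(2,3)]
    show ?thesis unfolding \<delta>_def m_def by simp
  qed
  have mT': "m E \<le> m F + \<delta>" if "E \<subseteq> Q" "T' ` E \<subseteq> F" "F \<subseteq> Q" for E F
  proof -
    \<comment> \<open>Reindexing by the inverse shear turns its defect on \<open>E\<close> into the
      defect of the shear on a subset of \<open>Q\<close>.\<close>
    have "(\<Sum>p\<in>E. (g (T' p) - g p)\<^sup>2) = (\<Sum>p\<in>T' ` E. (g (T p) - g p)\<^sup>2)"
      unfolding sum.reindex[OF inj(2)] by (simp add: T_def T'_def power2_commute)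
    also have "\<dots> \<le> (\<Sum>p\<in>Q. (g (T p) - g p)\<^sup>2)"
      using that fin by (intro sum_mono2) auto
    finally have "(\<Sum>p\<in>E. (g (T' p) - g p)\<^sup>2) \<le> A"
      using shear by (simp add: T_def)
    from sum_squares_le_image[OF fin that(1) inj(2) order_trans[OF that(2,3)] this] mono[OF that(2,3)]
    show ?thesis unfolding \<delta>_def m_def by simp
  qed
  define S where "S = {-r..r} \<times> {-r..r}"
  have SQ: "S \<subseteq> Q" using r by (auto simp: S_def Q_def)
  \<comment> \<open>The tail in the first coordinate costs \<open>A\<close>. The rotation carries
    the tail in the second coordinate into it, at cost \<open>A + \<delta>\<close>.\<close>
  define \<delta>' where "\<delta>' = 2 * A + \<delta>"
  have out: "m (Q - S) \<le> \<delta>'"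
  proof -
    let ?K = "{p\<in>Q. r < \<bar>fst p\<bar>}" and ?L = "{p\<in>Q. r < \<bar>snd p\<bar>}"
    have "m ?K \<le> A" using far by (simp add: m_def)
    moreover have "m ?L \<le> m ?K + \<delta>"
      by (rule mR) (auto simp: R_def Q_def)
    moreover have "m (Q - S) \<le> m (?K \<union> ?L)"
      by (rule mono) (auto simp: S_def Q_def)
    moreover have "m (?K \<union> ?L) \<le> m ?K + m ?L"
      by (rule un) auto
    ultimately show ?thesis by (simp add: \<delta>'_def)
  qed
  have out_un: "m (E \<union> (Q - S)) \<le> m E + \<delta>'" if "E \<subseteq> Q" for E
    using un[OF that, of "Q - S"] out by auto
  have cone: "m {p\<in>S. P p \<and> \<bar>snd p\<bar> < \<bar>fst p\<bar>} \<le> \<delta> + \<delta>'"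
    if "m {p\<in>S. P p} \<le> m ({p\<in>S. P p \<and> \<bar>fst p\<bar> \<le> \<bar>snd p\<bar>} \<union> (Q - S)) + \<delta>" for P
  proof -
    have "m {p\<in>S. P p} = m {p\<in>S. P p \<and> \<bar>fst p\<bar> \<le> \<bar>snd p\<bar>} + m {p\<in>S. P p \<and> \<bar>snd p\<bar> < \<bar>fst p\<bar>}"
      unfolding m_def using finite_subset[OF SQ fin]
      by (subst sum.union_disjoint[symmetric]) (auto intro!: sum.cong)
    moreover have "m ({p\<in>S. P p \<and> \<bar>fst p\<bar> \<le> \<bar>snd p\<bar>} \<union> (Q - S)) \<le> m {p\<in>S. P p \<and> \<bar>fst p\<bar> \<le> \<bar>snd p\<bar>} + \<delta>'"
      by (rule out_un) (use SQ in auto)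
    ultimately show ?thesis using that by linarith
  qed
  let ?C1 = "{p\<in>S. (fst p > 0 \<and> snd p \<ge> 0 \<or> fst p < 0 \<and> snd p \<le> 0) \<and> \<bar>snd p\<bar> < \<bar>fst p\<bar>}"
  let ?C2 = "{p\<in>S. (fst p > 0 \<and> snd p \<le> 0 \<or> fst p < 0 \<and> snd p \<ge> 0) \<and> \<bar>snd p\<bar> < \<bar>fst p\<bar>}"
  let ?H = "{p\<in>S. \<bar>snd p\<bar> < \<bar>fst p\<bar>}" and ?V = "{p\<in>S. \<bar>fst p\<bar> < \<bar>snd p\<bar>}"
  \<comment> \<open>The shear (or its inverse) maps a pair of opposite quadrants into its part above the diagonals, so the
    part below the diagonals carries little mass.\<close>
  have c1: "m ?C1 \<le> \<delta> + \<delta>'"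
    by (rule cone, rule mT) (use r in \<open>auto simp: T_def S_def Q_def\<close>)
  have c2: "m ?C2 \<le> \<delta> + \<delta>'"
    by (rule cone, rule mT') (use r in \<open>auto simp: T'_def S_def Q_def\<close>)
  have "m ?H \<le> m (?C1 \<union> ?C2)"
    by (rule mono) (use SQ in auto)
  also have "\<dots> \<le> m ?C1 + m ?C2"
    by (rule un) (use SQ in auto)
  finally have H: "m ?H \<le> 2 * \<delta> + 2 * \<delta>'"
    using c1 c2 by linarith
  have "m ?V \<le> m ?H + \<delta>"
    by (rule mR) (use SQ in \<open>auto simp: R_def S_def\<close>)
  then have V: "m ?V \<le> 3 * \<delta> + 2 * \<delta>'" using H by simp
  have VQ: "?V \<subseteq> Q" using SQ by auto
  \<comment> \<open>The shear sends \<open>(k, k)\<close> to \<open>(k, 2 * k)\<close>, which lies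
    in \<open>?V\<close> or outside \<open>S\<close>; the inverse shear treats the antidiagonal in
    the same way.\<close>
  have D1: "m {p\<in>S. fst p \<noteq> 0 \<and> snd p = fst p} \<le> 4 * \<delta> + 3 * \<delta>'" (is "m ?D1 \<le> _")
  proof -
    have "m ?D1 \<le> m (?V \<union> (Q - S)) + \<delta>"
      by (rule mT) (use r in \<open>auto simp: T_def S_def Q_def\<close>)
    then show ?thesis using V out_un[OF VQ] by simp
  qed
  have D2: "m {p\<in>S. fst p \<noteq> 0 \<and> snd p = - fst p} \<le> 4 * \<delta> + 3 * \<delta>'" (is "m ?D2 \<le> _")
  proof -
    have "m ?D2 \<le> m (?V \<union> (Q - S)) + \<delta>"
      by (rule mT') (use r in \<open>auto simp: T'_def S_def Q_def\<close>)
    then show ?thesis using V out_un[OF VQ] by simp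
  qed
  have z: "m {(0, 0)} = 0" by (simp add: m_def g0)
  \<comment> \<open>The origin, the two open double cones, the two punctured diagonals and the
    exterior of \<open>S\<close> exhaust \<open>Q\<close>.\<close>
  have "Q = (({(0, 0)} \<union> ?H) \<union> (?V \<union> (?D1 \<union> ?D2))) \<union> (Q - S)"
    using r SQ by (auto simp: S_def Q_def abs_if split: if_splits)
  then have "m Q \<le> m (({(0, 0)} \<union> ?H) \<union> (?V \<union> (?D1 \<union> ?D2))) + \<delta>'"
    using out_un[of "({(0, 0)} \<union> ?H) \<union> (?V \<union> (?D1 \<union> ?D2))"] SQ r by (auto simp: Q_def)
  also have "m (({(0, 0)} \<union> ?H) \<union> (?V \<union> (?D1 \<union> ?D2))) \<le> m ({(0, 0)} \<union> ?H) + m (?V \<union> (?D1 \<union> ?D2))"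
    using SQ r by (intro un) (auto simp: Q_def)
  also have "m ({(0, 0)} \<union> ?H) \<le> m {(0, 0)} + m ?H"
    using SQ r by (intro un) (auto simp: Q_def)
  also have "m (?V \<union> (?D1 \<union> ?D2)) \<le> m ?V + m (?D1 \<union> ?D2)"
    using SQ by (intro un) auto
  also have "m (?D1 \<union> ?D2) \<le> m ?D1 + m ?D2"
    using SQ by (intro un) auto
  finally have "m Q \<le> 13 * \<delta> + 11 * \<delta>'"
    using z H V D1 D2 by simp
  \<comment> \<open>Since \<open>\<delta>' = 2 * A + \<delta>\<close>, the bound is
    \<open>24 * \<delta> + 22 * A\<close>, which is half of \<open>m Q\<close> plus
    \<open>1198 * A\<close>; the half is absorbed on the left.\<close>
  then show ?thesis
    unfolding \<delta>'_def \<delta>_def m_def by simp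
qed

section \<open>The clock, chirp and Fourier matrices on the Weyl transform\<close>

definition unity_root :: "nat \<Rightarrow> int \<Rightarrow> complex" where
  "unity_root n x = cis (2 * pi * of_int x / of_nat n)"

text \<open>The linear term in the phase makes the chirp \<open>n\<close>-periodic for odd \<open>n\<close> as well as for even \<open>n\<close>.\<close>

definition chirp :: "nat \<Rightarrow> int \<Rightarrow> complex" where
  "chirp n x = cis (pi * ((of_int x)\<^sup>2 / of_nat n + of_int x))"

text \<open>Up to normalisation, the coefficient of \<open>b\<close> at the product of the \<open>k\<close>-th power of the cyclic
  shift and the \<open>l\<close>-th power of the clock matrix.\<close>

definition weyl :: "nat \<Rightarrow> (int \<Rightarrow> int \<Rightarrow> complex) \<Rightarrow> int \<Rightarrow> int \<Rightarrow> complex" where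
  "weyl n b k l = (\<Sum>i\<in>{0..<int n}. b i (i + k) * unity_root n (- (i * l)))"

section \<open>Roots of unity and quadratic phases\<close>

lemma unity_root_add: "unity_root n (x + y) = unity_root n x * unity_root n y"
  by (simp add: unity_root_def cis_mult add_divide_distrib ring_distribs)

lemma unity_root_0 [simp]: "unity_root n 0 = 1"
  by (simp add: unity_root_def)

lemma cnj_unity_root: "cnj (unity_root n x) = unity_root n (- x)"
  by (simp add: unity_root_def cis_cnj)

lemma norm_unity_root [simp]: "cmod (unity_root n x) = 1"
  by (simp add: unity_root_def)

lemma norm_chirp [simp]: "cmod (chirp n x) = 1"
  by (simp add: chirp_def)

lemma cis_eq_one_iff: "cis x = 1 \<longleftrightarrow> (\<exists>m::int. x = of_int m * 2 * pi)"
  using cos_one_2pi_int[of x] sin_cos_eq_iff[of x 0]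
  by (auto simp: complex_eq_iff sin_zero_iff_int2)

lemma unity_root_eq_1_iff:
  assumes "n > 0" shows "unity_root n x = 1 \<longleftrightarrow> int n dvd x"
proof -
  have "(2 * pi * of_int x / of_nat n = of_int m * 2 * pi) \<longleftrightarrow> x = int n * m" for m
  proof -
    have "(2 * pi * of_int x / of_nat n = of_int m * 2 * pi) \<longleftrightarrow> real_of_int x = real_of_int (int n * m)"
      using assms by (auto simp: field_simps)
    then show ?thesis by linarith
  qed
  then show ?thesis by (auto simp: unity_root_def cis_eq_one_iff dvd_def)
qed

lemma unity_root_periodic:
  assumes "n > 0" "int n dvd x - y" shows "unity_root n x = unity_root n y"
  using unity_root_add[of n "x - y" y] unity_root_eq_1_iff[OF assms(1), of "x - y"] assms by simp

text \<open>The difference of a quadratic phase is linear in \<open>x\<close>. This is why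
  conjugation by the chirp shifts frequencies and becomes a shear.\<close>

lemma chirp_mult_cnj:
  "chirp n x * cnj (chirp n (x + k)) = cnj (chirp n k) * unity_root n (- (x * k))"
  unfolding chirp_def unity_root_def cis_cnj cis_mult
  by (rule arg_cong[of _ _ cis])
     (simp add: power2_eq_square add_divide_distrib algebra_simps)

lemma chirp_periodic:
  assumes "n > 0" shows "chirp n (x + int n) = chirp n x"
proof -
  \<comment> \<open>The phase at \<open>n\<close> is pi times \<open>n + n\<close>, a multiple of a
    full turn for either parity of \<open>n\<close>.\<close>
  have "chirp n (int n) = unity_root n (int n * int n)"
    using assms unfolding chirp_def unity_root_def
    by (intro arg_cong[of _ _ cis]) (simp add: power2_eq_square)
  then have "chirp n (int n) = 1"
    using unity_root_eq_1_iff[OF assms] by simp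
  with chirp_mult_cnj[of n x "int n"] have "chirp n x * cnj (chirp n (x + int n)) = 1"
    using unity_root_eq_1_iff[OF assms, of "- (x * int n)"] by simp
  then have "chirp n x * (cnj (chirp n (x + int n)) * chirp n (x + int n)) = chirp n (x + int n)"
    by (simp add: mult.assoc[symmetric])
  then show ?thesis
    by (simp add: chirp_def cis_cnj cis_mult)
qed

section \<open>Sums over a period and the Parseval identity\<close>

lemma periodic_mult:
  fixes F :: "int \<Rightarrow> 'a"
  assumes "\<And>x. F (x + p) = F x"
  shows "F (x + m * p) = F x"
proof (induction m arbitrary: x rule: int_induct[of _ 0])
  case base then show ?case by simp
next
  case (step1 i)
  then show ?case using assms[of "x + i * p"] by (simp add: algebra_simps)
next
  case (step2 i)
  then show ?case using assms[of "x + (i - 1) * p"] by (simp add: algebra_simps)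
qed

lemma periodic_cong:
  fixes F :: "int \<Rightarrow> 'a"
  assumes "\<And>x. F (x + p) = F x" "p dvd x - y"
  shows "F x = F y"
proof -
  obtain m where "x - y = p * m" using assms(2) by auto
  then have "x = y + m * p" by (simp add: algebra_simps)
  then show ?thesis using periodic_mult[of F, OF assms(1)] by simp
qed

lemma periodic_sum_shift:
  fixes F :: "int \<Rightarrow> 'a :: comm_monoid_add"
  assumes n: "n > 0" and F: "\<And>x. F (x + n) = F x"
  shows "(\<Sum>i\<in>{0..<n}. F (i + l)) = (\<Sum>i\<in>{0..<n}. F i)"
proof (rule sum.reindex_bij_witness[of _ "\<lambda>i. (i - l) mod n" "\<lambda>i. (i + l) mod n"])
  fix i assume "i \<in> {0..<n}"
  then show "((i + l) mod n - l) mod n = i" "((i - l) mod n + l) mod n = i"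
    "(i + l) mod n \<in> {0..<n}" "(i - l) mod n \<in> {0..<n}"
    using n by (simp_all add: mod_simps)
  show "F ((i + l) mod n) = F (i + l)"
    by (rule periodic_cong[of F n]) (use F in \<open>auto simp: mod_eq_dvd_iff[symmetric]\<close>)
qed

lemma unity_root_sum:
  assumes n: "n > 0"
  shows "(\<Sum>j\<in>{0..<int n}. unity_root n (j * x)) = (if int n dvd x then of_nat n else 0)"
proof (cases "int n dvd x")
  case True
  then have "unity_root n (j * x) = 1" for j
    using unity_root_eq_1_iff[OF n] by simp
  then show ?thesis using True by simp
next
  case False
  have per: "unity_root n ((j + int n) * x) = unity_root n (j * x)" for j
    by (rule unity_root_periodic[OF n]) (simp add: algebra_simps)
  \<comment> \<open>Shifting the index multiplies the sum by \<open>unity_root n x\<close>, which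
    differs from 1, so the sum vanishes.\<close>
  have "(\<Sum>j\<in>{0..<int n}. unity_root n (j * x)) = (\<Sum>j\<in>{0..<int n}. unity_root n ((j + 1) * x))"
    using periodic_sum_shift[of "int n" "\<lambda>j. unity_root n (j * x)" 1] n per by simp
  also have "\<dots> = unity_root n x * (\<Sum>j\<in>{0..<int n}. unity_root n (j * x))"
    by (simp add: ring_distribs unity_root_add sum_distrib_left mult.commute)
  finally show ?thesis using False unity_root_eq_1_iff[OF n, of x] by simp
qed

lemma unity_root_sum_delta:
  assumes n: "n > 0" and G: "\<And>x. G (x + int n) = G x"
  shows "(\<Sum>p\<in>{0..<int n}. G p * (\<Sum>j\<in>{0..<int n}. unity_root n (j * (p - q)))) = of_nat n * G q"
proof -
  have "(\<Sum>p\<in>{0..<int n}. G p * (\<Sum>j\<in>{0..<int n}. unity_root n (j * (p - q))))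
      = (\<Sum>p\<in>{0..<int n}. if p = q mod int n then of_nat n * G p else 0)"
  proof (rule sum.cong[OF refl])
    fix p assume "p \<in> {0..<int n}"
    then have "int n dvd p - q \<longleftrightarrow> p = q mod int n"
      by (auto simp: mod_eq_dvd_iff[symmetric])
    then show "G p * (\<Sum>j\<in>{0..<int n}. unity_root n (j * (p - q)))
        = (if p = q mod int n then of_nat n * G p else 0)"
      by (simp add: unity_root_sum[OF n])
  qed
  also have "\<dots> = of_nat n * G (q mod int n)"
    using n by simp
  also have "G (q mod int n) = G q"
    by (rule periodic_cong[of G "int n"]) (use G in \<open>auto simp: mod_eq_dvd_iff[symmetric]\<close>)
  finally show ?thesis .
qed

text \<open>Expanding the square leaves geometric sums that vanish unless \<open>i = j\<close>. The
  sign \<open>s\<close> covers the Fourier matrix and its adjoint at once.\<close>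

lemma parseval:
  assumes n: "n > 0" and s: "\<bar>s\<bar> = 1"
  shows "(\<Sum>l\<in>{0..<int n}. (cmod (\<Sum>i\<in>{0..<int n}. a i * unity_root n (s * (i * l))))\<^sup>2)
    = of_nat n * (\<Sum>i\<in>{0..<int n}. (cmod (a i))\<^sup>2)"
proof -
  let ?I = "{0..<int n}"
  have eq: "int n dvd s * (i - j) \<longleftrightarrow> i = j" if "i \<in> ?I" "j \<in> ?I" for i j
  proof -
    have "s = 1 \<or> s = -1" using s by linarith
    then have "int n dvd s * (i - j) \<longleftrightarrow> i mod int n = j mod int n"
      by (auto simp: mod_eq_dvd_iff dvd_diff_commute)
    then show ?thesis using that by auto
  qed
  have "complex_of_real (\<Sum>l\<in>?I. (cmod (\<Sum>i\<in>?I. a i * unity_root n (s * (i * l))))\<^sup>2)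
      = (\<Sum>l\<in>?I. (\<Sum>i\<in>?I. a i * unity_root n (s * (i * l))) * cnj (\<Sum>j\<in>?I. a j * unity_root n (s * (j * l))))"
    by (simp only: of_real_sum complex_norm_square)
  also have "\<dots> = (\<Sum>l\<in>?I. \<Sum>i\<in>?I. \<Sum>j\<in>?I. a i * cnj (a j) * unity_root n (l * (s * (i - j))))"
    unfolding cnj_sum sum_product
    by (intro sum.cong refl)
       (simp add: cnj_unity_root unity_root_add[symmetric] algebra_simps)
  also have "\<dots> = (\<Sum>i\<in>?I. \<Sum>l\<in>?I. \<Sum>j\<in>?I. a i * cnj (a j) * unity_root n (l * (s * (i - j))))"
    by (rule sum.swap)
  also have "\<dots> = (\<Sum>i\<in>?I. \<Sum>j\<in>?I. \<Sum>l\<in>?I. a i * cnj (a j) * unity_root n (l * (s * (i - j))))"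
    by (intro sum.cong refl sum.swap)
  also have "\<dots> = (\<Sum>i\<in>?I. \<Sum>j\<in>?I. if i = j then a i * cnj (a j) * of_nat n else 0)"
    unfolding sum_distrib_left[symmetric] unity_root_sum[OF n]
    by (intro sum.cong refl) (simp add: eq)
  also have "\<dots> = (\<Sum>i\<in>?I. of_nat n * (of_real ((cmod (a i))\<^sup>2)))"
    by (intro sum.cong refl) (simp add: complex_norm_square mult.commute del: of_real_power)
  also have "\<dots> = complex_of_real (of_nat n * (\<Sum>i\<in>?I. (cmod (a i))\<^sup>2))"
    by (simp add: sum_distrib_left)
  finally show ?thesis by (simp only: of_real_eq_iff)
qed

section \<open>Weyl coefficients under conjugation by the three unitaries\<close>

lemma weyl_periodic_shift:
  assumes b: "\<And>i j. b i (j + int n) = b i j"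
  shows "weyl n b (k + int n) l = weyl n b k l"
  using b[of _ "_ + k"] by (simp add: weyl_def add.assoc[symmetric])

lemma weyl_periodic_frequency:
  assumes n: "n > 0"
  shows "weyl n b k (l + int n) = weyl n b k l"
  unfolding weyl_def
  by (intro sum.cong refl arg_cong2[of _ _ _ _ "(*)"] unity_root_periodic[OF n]) (simp add: algebra_simps)

text \<open>For fixed \<open>k\<close> the coefficients are the Fourier transform of the
  \<open>k\<close>-th cyclic diagonal, so \<open>parseval\<close> applies to each diagonal; the
  \<open>n\<close> diagonals together cover every entry once.\<close>

lemma weyl_parseval:
  assumes n: "n > 0" and b: "\<And>i j. b i (j + int n) = b i j"
  shows "(\<Sum>k\<in>{0..<int n}. \<Sum>l\<in>{0..<int n}. (cmod (weyl n b k l))\<^sup>2)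
    = of_nat n * (\<Sum>i\<in>{0..<int n}. \<Sum>j\<in>{0..<int n}. (cmod (b i j))\<^sup>2)"
proof -
  have shift: "(\<Sum>k\<in>{0..<int n}. (cmod (b i (k + i)))\<^sup>2) = (\<Sum>j\<in>{0..<int n}. (cmod (b i j))\<^sup>2)" for i
    using periodic_sum_shift[of "int n" "\<lambda>j. (cmod (b i j))\<^sup>2" i] n b by simp
  have "(\<Sum>k\<in>{0..<int n}. \<Sum>l\<in>{0..<int n}. (cmod (weyl n b k l))\<^sup>2)
      = (\<Sum>k\<in>{0..<int n}. of_nat n * (\<Sum>i\<in>{0..<int n}. (cmod (b i (i + k)))\<^sup>2))"
    using parseval[OF n, of "-1"] by (simp add: weyl_def)
  also have "\<dots> = of_nat n * (\<Sum>i\<in>{0..<int n}. \<Sum>k\<in>{0..<int n}. (cmod (b i (k + i)))\<^sup>2)"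
    unfolding sum_distrib_left[symmetric] by (subst sum.swap) (simp add: add.commute)
  finally show ?thesis by (simp add: shift)
qed

text \<open>The left-hand function is the conjugate of \<open>b\<close> by the clock matrix minus
  \<open>b\<close>; the factor \<open>unity_root n (i - j)\<close> is constant along each cyclic
  diagonal.\<close>

lemma weyl_clock:
  "weyl n (\<lambda>i j. (unity_root n (i - j) - 1) * b i j) k l = (unity_root n (- k) - 1) * weyl n b k l"
  by (simp add: weyl_def sum_distrib_left mult.assoc)

text \<open>Along the \<open>k\<close>-th diagonal, conjugation by the chirp multiplies by a linear
  phase of slope \<open>k\<close>, which moves the frequency \<open>l\<close> to
  \<open>l + k\<close>.\<close>

lemma weyl_chirp:
  "weyl n (\<lambda>i j. (chirp n i * cnj (chirp n j) - 1) * b i j) k l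
    = cnj (chirp n k) * weyl n b k (l + k) - weyl n b k l"
proof -
  have "unity_root n (- (i * (l + k))) = unity_root n (- (i * k)) * unity_root n (- (i * l))" for i
    by (simp add: unity_root_add[symmetric] algebra_simps)
  note * = this
  show ?thesis
    unfolding weyl_def sum_distrib_left sum_subtractf[symmetric] chirp_mult_cnj *
    by (intro sum.cong refl) (simp add: left_diff_distrib right_diff_distrib mult_ac)
qed

text \<open>Here \<open>c\<close> is the commutator with the unnormalised Fourier matrix.
  Multiplying on the right by the adjoint turns it into the conjugate of \<open>b\<close> minus
  \<open>n\<close> times \<open>b\<close>, and Fourier conjugation exchanges translation and
  frequency up to a sign and a phase.\<close>

lemma weyl_fourier:
  assumes n: "n > 0" and per: "\<And>i j. b (i + int n) j = b i j" "\<And>i j. b i (j + int n) = b i j"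
  defines "c \<equiv> \<lambda>i j. \<Sum>p\<in>{0..<int n}. unity_root n (i * p) * b p j - b i p * unity_root n (p * j)"
  shows "weyl n (\<lambda>i q. \<Sum>j\<in>{0..<int n}. c i j * unity_root n (- (j * q))) k l
    = of_nat n * (unity_root n (k * l) * weyl n b (- l) k - weyl n b k l)"
proof -
  let ?I = "{0..<int n}"
  \<comment> \<open>This is \<open>b\<close> multiplied by the unnormalised Fourier matrix on the
    left and by its adjoint on the right.\<close>
  define E where "E i q = (\<Sum>p\<in>?I. \<Sum>j\<in>?I. unity_root n (i * p - j * q) * b p j)" for i q
  have "(\<Sum>j\<in>?I. c i j * unity_root n (- (j * q))) = E i q - of_nat n * b i q" for i q
  proof -
    have "(\<Sum>j\<in>?I. c i j * unity_root n (- (j * q)))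
        = (\<Sum>j\<in>?I. \<Sum>p\<in>?I. unity_root n (i * p - j * q) * b p j)
          - (\<Sum>j\<in>?I. \<Sum>p\<in>?I. b i p * unity_root n (j * (p - q)))"
      unfolding c_def sum_distrib_right sum_subtractf[symmetric] left_diff_distrib
      by (intro sum.cong refl) (simp add: unity_root_add[symmetric] unity_root_add[of n _ "- _", symmetric] algebra_simps)
    also have "(\<Sum>j\<in>?I. \<Sum>p\<in>?I. b i p * unity_root n (j * (p - q)))
        = (\<Sum>p\<in>?I. b i p * (\<Sum>j\<in>?I. unity_root n (j * (p - q))))"
      by (subst sum.swap) (simp add: sum_distrib_left)
    also have "\<dots> = of_nat n * b i q"
      by (rule unity_root_sum_delta[OF n]) (rule per)
    also have "(\<Sum>j\<in>?I. \<Sum>p\<in>?I. unity_root n (i * p - j * q) * b p j) = E i q"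
      unfolding E_def by (rule sum.swap)
    finally show ?thesis .
  qed
  then have "weyl n (\<lambda>i q. \<Sum>j\<in>?I. c i j * unity_root n (- (j * q))) k l
      = (\<Sum>i\<in>?I. E i (i + k) * unity_root n (- (i * l))) - of_nat n * weyl n b k l"
    by (simp add: weyl_def left_diff_distrib sum_subtractf sum_distrib_left mult.assoc)
  also have "(\<Sum>i\<in>?I. E i (i + k) * unity_root n (- (i * l)))
      = (\<Sum>i\<in>?I. \<Sum>j\<in>?I. \<Sum>p\<in>?I. b p j * unity_root n (- (j * k)) * unity_root n (i * (p - (j + l))))"
  proof (intro sum.cong refl)
    fix i
    have "unity_root n (i * p - j * (i + k)) * unity_root n (- (i * l))
        = unity_root n (- (j * k)) * unity_root n (i * (p - (j + l)))" for p j
      by (simp add: unity_root_add[symmetric] algebra_simps)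
    then have "E i (i + k) * unity_root n (- (i * l))
      = (\<Sum>p\<in>?I. \<Sum>j\<in>?I. b p j * unity_root n (- (j * k)) * unity_root n (i * (p - (j + l))))"
      unfolding E_def sum_distrib_right by (intro sum.cong refl) (simp add: mult.assoc mult.left_commute)
    also have "\<dots> = (\<Sum>j\<in>?I. \<Sum>p\<in>?I. b p j * unity_root n (- (j * k)) * unity_root n (i * (p - (j + l))))"
      by (rule sum.swap)
    finally show "E i (i + k) * unity_root n (- (i * l)) = \<dots>" .
  qed
  also have "\<dots> = (\<Sum>j\<in>?I. \<Sum>i\<in>?I. \<Sum>p\<in>?I. b p j * unity_root n (- (j * k)) * unity_root n (i * (p - (j + l))))"
    by (rule sum.swap)
  also have "\<dots> = (\<Sum>j\<in>?I. unity_root n (- (j * k)) * (\<Sum>p\<in>?I. b p j * (\<Sum>i\<in>?I. unity_root n (i * (p - (j + l))))))"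
    by (intro sum.cong refl, subst sum.swap) (simp add: sum_distrib_left mult.assoc mult.left_commute)
  also have "\<dots> = (\<Sum>j\<in>?I. unity_root n (- (j * k)) * (of_nat n * b (j + l) j))"
    using unity_root_sum_delta[OF n, of "\<lambda>p. b p _"] per(1) by simp
  \<comment> \<open>Summing over a translated period puts the remaining sum on the cyclic diagonal
    of index \<open>- l\<close>.\<close>
  also have "\<dots> = (\<Sum>j\<in>?I. unity_root n (- ((j - l) * k)) * (of_nat n * b j (j - l)))"
  proof -
    define G where "G j = unity_root n (- ((j - l) * k)) * (of_nat n * b j (j - l))" for j
    have "unity_root n (- ((j + int n - l) * k)) = unity_root n (- ((j - l) * k))" for j
      by (rule unity_root_periodic[OF n]) (simp add: algebra_simps)
    moreover have "b j (j + int n - l) = b j (j - l)" for j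
      using per(2)[of j "j - l"] by (simp add: algebra_simps)
    ultimately have "G (j + int n) = G j" for j
      by (simp add: G_def per)
    from periodic_sum_shift[of "int n" G l, OF _ this] n
    show ?thesis by (simp add: G_def)
  qed
  also have "\<dots> = of_nat n * (unity_root n (k * l) * weyl n b (- l) k)"
  proof -
    have "unity_root n (- ((j - l) * k)) = unity_root n (k * l) * unity_root n (- (j * k))" for j
      by (simp add: unity_root_add[symmetric] algebra_simps)
    then show ?thesis
      unfolding weyl_def sum_distrib_left by (intro sum.cong refl) (simp add: algebra_simps)
  qed
  finally show ?thesis by (simp add: right_diff_distrib)
qed

text \<open>For even \<open>n\<close> the symmetric interval has \<open>n + 1\<close> elements, so one residue is counted twice.\<close>

lemma periodic_sum_le_symmetric:
  fixes F :: "int \<Rightarrow> real"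
  assumes n: "n > 0" and F: "\<And>x. F (x + n) = F x" "\<And>x. F x \<ge> 0"
  shows "(\<Sum>x\<in>{0..<n}. F x) \<le> (\<Sum>x\<in>{- (n div 2)..n div 2}. F x)"
    and "(\<Sum>x\<in>{- (n div 2)..n div 2}. F x) \<le> 2 * (\<Sum>x\<in>{0..<n}. F x)"
proof -
  have sh: "(\<Sum>x\<in>{a..<b}. F x) = (\<Sum>x\<in>{a - n..<b - n}. F x)" for a b
    by (rule sum.reindex_bij_witness[of _ "\<lambda>x. x + n" "\<lambda>x. x - n"]) (use F(1)[of "_ - n"] in auto)
  let ?h = "n div 2"
  have h: "0 \<le> ?h" "?h < n" "n \<le> 2 * ?h + 1" using n by auto
  \<comment> \<open>The upper half of the period, moved down by \<open>n\<close>, fits with the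
    lower half into the symmetric window because \<open>n \<le> 2 * ?h + 1\<close>.\<close>
  have "(\<Sum>x\<in>{0..<n}. F x) = (\<Sum>x\<in>{0..<?h + 1} \<union> {?h + 1..<n}. F x)"
    using h by (intro sum.cong) auto
  also have "\<dots> = (\<Sum>x\<in>{0..<?h + 1}. F x) + (\<Sum>x\<in>{?h + 1..<n}. F x)"
    by (rule sum.union_disjoint) auto
  also have "\<dots> = (\<Sum>x\<in>{?h + 1 - n..<n - n} \<union> {0..<?h + 1}. F x)"
    unfolding sh[of "?h + 1" n] by (subst sum.union_disjoint) auto
  also have "\<dots> \<le> (\<Sum>x\<in>{- ?h..?h}. F x)"
    using h F by (intro sum_mono2) auto
  finally show "(\<Sum>x\<in>{0..<n}. F x) \<le> (\<Sum>x\<in>{- ?h..?h}. F x)" .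
  have "(\<Sum>x\<in>{- ?h..?h}. F x) \<le> (\<Sum>x\<in>{0 - n..<n - n} \<union> {0..<n}. F x)"
    using h F by (intro sum_mono2) auto
  also have "\<dots> = 2 * (\<Sum>x\<in>{0..<n}. F x)"
    unfolding mult_2 using sh[of 0 n] by (subst sum.union_disjoint) auto
  finally show "(\<Sum>x\<in>{- ?h..?h}. F x) \<le> 2 * (\<Sum>x\<in>{0..<n}. F x)" .
qed

lemma periodic_sum2_le_symmetric:
  fixes F :: "int \<Rightarrow> int \<Rightarrow> real" and n :: int
  defines "Q \<equiv> {- (n div 2)..n div 2} \<times> {- (n div 2)..n div 2}"
  assumes n: "n > 0" and F: "\<And>x y. F (x + n) y = F x y" "\<And>x y. F x (y + n) = F x y" "\<And>x y. F x y \<ge> 0"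
  shows "(\<Sum>x\<in>{0..<n}. \<Sum>y\<in>{0..<n}. F x y) \<le> (\<Sum>p\<in>Q. F (fst p) (snd p))"
    and "(\<Sum>p\<in>Q. F (fst p) (snd p)) \<le> 4 * (\<Sum>x\<in>{0..<n}. \<Sum>y\<in>{0..<n}. F x y)"
proof -
  let ?J = "{- (n div 2)..n div 2}"
  have Q: "(\<Sum>p\<in>Q. F (fst p) (snd p)) = (\<Sum>x\<in>?J. \<Sum>y\<in>?J. F x y)"
    unfolding Q_def by (simp add: sum.cartesian_product split_def)
  note 1 = periodic_sum_le_symmetric[of n "\<lambda>x. \<Sum>y\<in>?J. F x y", OF n]
  note 2 = periodic_sum_le_symmetric[of n "F _", OF n F(2) F(3)]
  have "(\<Sum>x\<in>{0..<n}. \<Sum>y\<in>{0..<n}. F x y) \<le> (\<Sum>x\<in>{0..<n}. \<Sum>y\<in>?J. F x y)"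
    by (intro sum_mono 2(1))
  also have "\<dots> \<le> (\<Sum>x\<in>?J. \<Sum>y\<in>?J. F x y)"
    by (intro 1(1)) (auto simp: F sum_nonneg)
  finally show "(\<Sum>x\<in>{0..<n}. \<Sum>y\<in>{0..<n}. F x y) \<le> (\<Sum>p\<in>Q. F (fst p) (snd p))"
    unfolding Q .
  have "(\<Sum>x\<in>?J. \<Sum>y\<in>?J. F x y) \<le> 2 * (\<Sum>x\<in>{0..<n}. \<Sum>y\<in>?J. F x y)"
    by (intro 1(2)) (auto simp: F sum_nonneg)
  also have "\<dots> \<le> 2 * (\<Sum>x\<in>{0..<n}. 2 * (\<Sum>y\<in>{0..<n}. F x y))"
    by (intro mult_left_mono sum_mono 2(2)) auto
  also have "\<dots> = 4 * (\<Sum>x\<in>{0..<n}. \<Sum>y\<in>{0..<n}. F x y)"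
    by (simp add: sum_distrib_left[symmetric])
  finally show "(\<Sum>p\<in>Q. F (fst p) (snd p)) \<le> 4 * (\<Sum>x\<in>{0..<n}. \<Sum>y\<in>{0..<n}. F x y)"
    unfolding Q .
qed

lemma norm_cis_diff_1: "(cmod (cis x - 1))\<^sup>2 = 2 - 2 * cos x"
  unfolding cmod_power2 using sin_cos_squared_add[of x] by (simp add: power2_diff)

text \<open>The angle has modulus between a quarter and a half turn, so its cosine is
  nonpositive.\<close>

lemma norm_unity_root_diff_1:
  assumes n: "n > 0" and k: "int n \<le> 4 * \<bar>k\<bar>" "2 * \<bar>k\<bar> \<le> int n"
  shows "1 \<le> (cmod (unity_root n k - 1))\<^sup>2"
proof -
  let ?x = "2 * pi * real_of_int k / real n"
  have *: "\<bar>?x\<bar> = pi * (2 * \<bar>real_of_int k\<bar> / real n)"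
    by (simp add: abs_mult)
  have "real_of_int (int n) \<le> real_of_int (4 * \<bar>k\<bar>)" "real_of_int (2 * \<bar>k\<bar>) \<le> real_of_int (int n)"
    using k by (simp_all only: of_int_le_iff)
  then have "1 / 2 \<le> 2 * \<bar>real_of_int k\<bar> / real n" "2 * \<bar>real_of_int k\<bar> / real n \<le> 1"
    using n by (auto simp: field_simps)
  from mult_left_mono[OF this(1), of pi] mult_left_mono[OF this(2), of pi]
  have "pi / 2 \<le> \<bar>?x\<bar>" "\<bar>?x\<bar> \<le> pi" unfolding * by simp_all
  then have "cos \<bar>?x\<bar> \<le> cos (pi / 2)"
    by (intro cos_monotone_0_pi_le) auto
  then have "cos ?x \<le> 0" by (simp only: cos_abs_real cos_pi_half)
  then show ?thesis
    by (simp add: unity_root_def norm_cis_diff_1)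
qed

section \<open>Commutator norms in Weyl coordinates and the spectral gap\<close>

lemma weyl_clock_norm:
  assumes n: "n > 0" and per: "\<And>i j. b i (j + int n) = b i j"
  shows "(\<Sum>k\<in>{0..<int n}. \<Sum>l\<in>{0..<int n}. (cmod ((unity_root n (- k) - 1) * weyl n b k l))\<^sup>2)
    = n * (\<Sum>i\<in>{0..<int n}. \<Sum>j\<in>{0..<int n}. (cmod ((unity_root n i - unity_root n j) * b i j))\<^sup>2)"
proof -
  let ?b = "\<lambda>i j. (unity_root n (i - j) - 1) * b i j"
  have "(\<Sum>k\<in>{0..<int n}. \<Sum>l\<in>{0..<int n}. (cmod (weyl n ?b k l))\<^sup>2)
      = n * (\<Sum>i\<in>{0..<int n}. \<Sum>j\<in>{0..<int n}. (cmod (?b i j))\<^sup>2)"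
  proof (rule weyl_parseval[OF n])
    show "?b i (j + int n) = ?b i j" for i j
      using unity_root_periodic[OF n, of "i - (j + int n)" "i - j"] by (simp add: per)
  qed
  moreover have "cmod (?b i j) = cmod ((unity_root n i - unity_root n j) * b i j)" for i j
  proof -
    have "unity_root n i - unity_root n j = unity_root n j * (unity_root n (i - j) - 1)"
      by (simp add: right_diff_distrib unity_root_add[symmetric])
    then show ?thesis by (simp add: norm_mult)
  qed
  ultimately show ?thesis by (simp add: weyl_clock)
qed

lemma weyl_chirp_norm:
  assumes n: "n > 0" and per: "\<And>i j. b i (j + int n) = b i j"
  shows "(\<Sum>k\<in>{0..<int n}. \<Sum>l\<in>{0..<int n}. (cmod (cnj (chirp n k) * weyl n b k (l + k) - weyl n b k l))\<^sup>2)
    = n * (\<Sum>i\<in>{0..<int n}. \<Sum>j\<in>{0..<int n}. (cmod ((chirp n i - chirp n j) * b i j))\<^sup>2)"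
proof -
  let ?b = "\<lambda>i j. (chirp n i * cnj (chirp n j) - 1) * b i j"
  have "(\<Sum>k\<in>{0..<int n}. \<Sum>l\<in>{0..<int n}. (cmod (weyl n ?b k l))\<^sup>2)
      = n * (\<Sum>i\<in>{0..<int n}. \<Sum>j\<in>{0..<int n}. (cmod (?b i j))\<^sup>2)"
    by (rule weyl_parseval[OF n]) (simp add: per chirp_periodic[OF n])
  moreover have "cmod (?b i j) = cmod ((chirp n i - chirp n j) * b i j)" for i j
  proof -
    have "chirp n j * cnj (chirp n j) = 1"
      by (simp add: chirp_def cis_cnj cis_mult)
    then have "chirp n i - chirp n j = chirp n j * (chirp n i * cnj (chirp n j) - 1)"
      by (simp add: right_diff_distrib mult.left_commute)
    then show ?thesis by (simp add: norm_mult)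
  qed
  ultimately show ?thesis by (simp add: weyl_chirp)
qed

text \<open>\<open>weyl_parseval\<close> contributes one factor \<open>n\<close> and the
  unnormalised adjoint Fourier matrix another; they cancel the square of the factor \<open>n\<close>
  in \<open>weyl_fourier\<close>.\<close>

lemma weyl_fourier_norm:
  assumes n: "n > 0" and per: "\<And>i j. b (i + int n) j = b i j" "\<And>i j. b i (j + int n) = b i j"
  shows "(\<Sum>k\<in>{0..<int n}. \<Sum>l\<in>{0..<int n}. (cmod (unity_root n (k * l) * weyl n b (- l) k - weyl n b k l))\<^sup>2)
    = (\<Sum>i\<in>{0..<int n}. \<Sum>j\<in>{0..<int n}.
      (cmod (\<Sum>p\<in>{0..<int n}. unity_root n (i * p) * b p j - b i p * unity_root n (p * j)))\<^sup>2)"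
    (is "?L = ?R")
proof -
  let ?I = "{0..<int n}"
  define c where "c i j = (\<Sum>p\<in>?I. unity_root n (i * p) * b p j - b i p * unity_root n (p * j))" for i j
  define bF where "bF = (\<lambda>i q. \<Sum>j\<in>?I. c i j * unity_root n (- (j * q)))"
  have "(\<Sum>k\<in>?I. \<Sum>l\<in>?I. (cmod (weyl n bF k l))\<^sup>2) = n * (\<Sum>i\<in>?I. \<Sum>j\<in>?I. (cmod (bF i j))\<^sup>2)"
  proof (rule weyl_parseval[OF n])
    have "unity_root n (- (j * (q + int n))) = unity_root n (- (j * q))" for j q
      by (rule unity_root_periodic[OF n]) (simp add: algebra_simps)
    then show "bF i (q + int n) = bF i q" for i q
      by (simp add: bF_def)
  qed
  also have "\<dots> = n * (n * ?R)"
    using parseval[OF n, of "-1"] by (simp add: bF_def c_def sum_distrib_left)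
  also have "(\<Sum>k\<in>?I. \<Sum>l\<in>?I. (cmod (weyl n bF k l))\<^sup>2) = n * (n * ?L)"
  proof -
    have "weyl n bF k l = n * (unity_root n (k * l) * weyl n b (- l) k - weyl n b k l)" for k l
      unfolding bF_def c_def by (rule weyl_fourier) (use n per in auto)
    then show ?thesis
      by (simp add: norm_mult power_mult_distrib sum_distrib_left power2_eq_square mult_ac)
  qed
  finally show ?thesis using n by simp
qed

text \<open>The moduli of the Weyl coefficients satisfy the hypotheses of
  \<open>shear_rotation_gap\<close>: the clock controls large \<open>k\<close>, the chirp gives the
  shear, the Fourier matrix the rotation, and zero trace makes the coefficient at the origin
  vanish.\<close>

lemma weyl_clock_chirp_fourier_gap:
  fixes b :: "int \<Rightarrow> int \<Rightarrow> complex"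
  assumes n: "n > 0" and per: "\<And>i j. b (i + int n) j = b i j" "\<And>i j. b i (j + int n) = b i j"
    and tr: "(\<Sum>i\<in>{0..<int n}. b i i) = 0"
  defines "CZ \<equiv> \<Sum>i\<in>{0..<int n}. \<Sum>j\<in>{0..<int n}. (cmod ((unity_root n i - unity_root n j) * b i j))\<^sup>2"
    and "CD \<equiv> \<Sum>i\<in>{0..<int n}. \<Sum>j\<in>{0..<int n}. (cmod ((chirp n i - chirp n j) * b i j))\<^sup>2"
    and "CF \<equiv> \<Sum>i\<in>{0..<int n}. \<Sum>j\<in>{0..<int n}.
      (cmod (\<Sum>p\<in>{0..<int n}. unity_root n (i * p) * b p j - b i p * unity_root n (p * j)))\<^sup>2"
  shows "(\<Sum>i\<in>{0..<int n}. \<Sum>j\<in>{0..<int n}. (cmod (b i j))\<^sup>2) \<le> 9584 * (CZ + CD + CF / n)"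
proof -
  let ?I = "{0..<int n}"
  define h where "h = int n div 2"
  \<comment> \<open>The largest integer below \<open>n / 4\<close>: beyond it the clock factor has
    modulus at least 1, and still \<open>2 * r \<le> h\<close>.\<close>
  define r where "r = (int n - 1) div 4"
  define Q where "Q = {-h..h} \<times> {-h..h}"
  define f where "f = weyl n b"
  define g where "g p = cmod (f (fst p) (snd p))" for p
  have fper: "f (k + int n) l = f k l" "f k (l + int n) = f k l" for k l
    unfolding f_def by (auto intro: weyl_periodic_shift weyl_periodic_frequency simp: n per)
  have fper': "f (- k - int n) l = f (- k) l" "f k (l + int n + k) = f k (l + k)"
      "f k (l + (k + int n)) = f k (l + k)" for k l
    using fper(1)[of "- k - int n" l] fper(2)[of k "l + k"]
    by (simp_all add: add_ac)
  have N0: "CZ \<ge> 0" "CD \<ge> 0" "CF \<ge> 0"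
    unfolding CZ_def CD_def CF_def by (auto intro!: sum_nonneg)
  \<comment> \<open>The symmetric window costs a factor 4 and Parseval a factor \<open>n\<close>.
    The term \<open>CF\<close> uses the unnormalised Fourier matrix and already contains that
    \<open>n\<close>.\<close>
  define A where "A = 4 * n * (CZ + CD + CF / n)"
  have A: "4 * (n * CZ) \<le> A" "4 * (n * CD) \<le> A" "4 * CF \<le> A"
    using N0 n by (auto simp: A_def algebra_simps)
  have mono: "(\<Sum>p\<in>Q. F (fst p) (snd p)) \<le> 4 * (\<Sum>k\<in>?I. \<Sum>l\<in>?I. F k l)"
    if "\<And>k l. F (k + int n) l = F k l" "\<And>k l. F k (l + int n) = F k l" "\<And>k l. F k l \<ge> 0"
    for F :: "int \<Rightarrow> int \<Rightarrow> real"
    unfolding Q_def h_def by (rule periodic_sum2_le_symmetric(2)) (use n that in auto)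
  \<comment> \<open>Passing to moduli removes the unimodular phases that accompany the shear and the
    rotation.\<close>
  have tri: "(cmod x - cmod y)\<^sup>2 \<le> (cmod (u * x - y))\<^sup>2" if "cmod u = 1" for u x y
    using norm_triangle_ineq3[of "u * x" y] that
    by (intro abs_le_square_iff[THEN iffD1]) (simp add: norm_mult)
  have "(\<Sum>p\<in>Q. (g p)\<^sup>2) \<le> 2396 * A"
    unfolding Q_def
  proof (rule shear_rotation_gap[of r])
    show "0 \<le> r" "2 * r \<le> h" using n by (auto simp: r_def h_def)
    show "g (0, 0) = 0" using tr by (simp add: g_def f_def weyl_def)
    have "(\<Sum>p\<in>{p\<in>Q. r < \<bar>fst p\<bar>}. (g p)\<^sup>2)
        \<le> (\<Sum>p\<in>{p\<in>Q. r < \<bar>fst p\<bar>}. (cmod ((unity_root n (- fst p) - 1) * f (fst p) (snd p)))\<^sup>2)"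
    proof (rule sum_mono)
      fix p assume "p \<in> {p\<in>Q. r < \<bar>fst p\<bar>}"
      then have "1 \<le> (cmod (unity_root n (- fst p) - 1))\<^sup>2"
        by (intro norm_unity_root_diff_1[OF n]) (auto simp: Q_def r_def h_def)
      from mult_right_mono[OF this, of "(g p)\<^sup>2"]
      show "(g p)\<^sup>2 \<le> (cmod ((unity_root n (- fst p) - 1) * f (fst p) (snd p)))\<^sup>2"
        by (simp add: g_def norm_mult power_mult_distrib)
    qed
    also have "\<dots> \<le> (\<Sum>p\<in>Q. (cmod ((unity_root n (- fst p) - 1) * f (fst p) (snd p)))\<^sup>2)"
      by (rule sum_mono2) (auto simp: Q_def)
    also have "\<dots> \<le> 4 * (\<Sum>k\<in>?I. \<Sum>l\<in>?I. (cmod ((unity_root n (- k) - 1) * f k l))\<^sup>2)"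
    proof (rule mono)
      show "(cmod ((unity_root n (- (k + int n)) - 1) * f (k + int n) l))\<^sup>2 = (cmod ((unity_root n (- k) - 1) * f k l))\<^sup>2" for k l
        using unity_root_periodic[OF n, of "- (k + int n)" "- k"] by (simp add: fper)
    qed (simp_all add: fper)
    also have "\<dots> = 4 * (n * CZ)"
      by (simp add: CZ_def f_def weyl_clock_norm[of n b, OF n per(2)])
    finally show "(\<Sum>p\<in>{p\<in>{-h..h} \<times> {-h..h}. r < \<bar>fst p\<bar>}. (g p)\<^sup>2) \<le> A"
      using A(1) by (simp add: Q_def)
  next
    have "(\<Sum>p\<in>Q. (g (fst p, snd p + fst p) - g p)\<^sup>2)
        \<le> (\<Sum>p\<in>Q. (cmod (cnj (chirp n (fst p)) * f (fst p) (snd p + fst p) - f (fst p) (snd p)))\<^sup>2)"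
      unfolding g_def by (intro sum_mono) (simp add: tri)
    also have "\<dots> \<le> 4 * (\<Sum>k\<in>?I. \<Sum>l\<in>?I. (cmod (cnj (chirp n k) * f k (l + k) - f k l))\<^sup>2)"
      by (rule mono) (auto simp: fper fper' chirp_periodic[OF n])
    also have "\<dots> = 4 * (n * CD)"
      by (simp add: CD_def f_def weyl_chirp_norm[of n b, OF n per(2)])
    finally show "(\<Sum>p\<in>{-h..h} \<times> {-h..h}. (g (fst p, snd p + fst p) - g p)\<^sup>2) \<le> A"
      using A(2) by (simp add: Q_def)
  next
    have "(\<Sum>p\<in>Q. (g (- snd p, fst p) - g p)\<^sup>2)
        \<le> (\<Sum>p\<in>Q. (cmod (unity_root n (fst p * snd p) * f (- snd p) (fst p) - f (fst p) (snd p)))\<^sup>2)"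
      unfolding g_def by (intro sum_mono) (simp add: tri)
    also have "\<dots> \<le> 4 * (\<Sum>k\<in>?I. \<Sum>l\<in>?I. (cmod (unity_root n (k * l) * f (- l) k - f k l))\<^sup>2)"
    proof (rule mono)
      fix k l
      have "unity_root n ((k + int n) * l) = unity_root n (k * l)"
           "unity_root n (k * (l + int n)) = unity_root n (k * l)"
        by (rule unity_root_periodic[OF n]; simp add: algebra_simps)+
      then show
        "(cmod (unity_root n ((k + int n) * l) * f (- l) (k + int n) - f (k + int n) l))\<^sup>2
          = (cmod (unity_root n (k * l) * f (- l) k - f k l))\<^sup>2"
        "(cmod (unity_root n (k * (l + int n)) * f (- (l + int n)) k - f k (l + int n)))\<^sup>2
          = (cmod (unity_root n (k * l) * f (- l) k - f k l))\<^sup>2"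
        by (simp_all add: fper fper')
    qed simp
    also have "\<dots> = 4 * CF"
      by (simp add: CF_def f_def weyl_fourier_norm[of n b, OF n per])
    finally show "(\<Sum>p\<in>{-h..h} \<times> {-h..h}. (g (- snd p, fst p) - g p)\<^sup>2) \<le> A"
      using A(3) by (simp add: Q_def)
  qed
  moreover have "n * (\<Sum>i\<in>?I. \<Sum>j\<in>?I. (cmod (b i j))\<^sup>2) = (\<Sum>k\<in>?I. \<Sum>l\<in>?I. (cmod (f k l))\<^sup>2)"
    unfolding f_def by (rule weyl_parseval[symmetric]) (use n per in auto)
  moreover have "\<dots> \<le> (\<Sum>p\<in>Q. (g p)\<^sup>2)"
    unfolding g_def Q_def h_def
    by (rule periodic_sum2_le_symmetric(1)) (use n in \<open>auto simp: fper\<close>)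
  ultimately have "n * (\<Sum>i\<in>?I. \<Sum>j\<in>?I. (cmod (b i j))\<^sup>2) \<le> 2396 * A"
    by linarith
  also have "2396 * A = n * (9584 * (CZ + CD + CF / n))"
    unfolding A_def by (simp only: mult_ac) simp
  finally show ?thesis using n by simp
qed

section \<open>Squared Frobenius norms and operator bounds\<close>

text \<open>For positive \<open>n\<close>, \<open>s = 1\<close> gives the unitary Fourier matrix and
  \<open>s = -1\<close> its adjoint; both are symmetric.\<close>

definition fourier :: "nat \<Rightarrow> int \<Rightarrow> nat \<Rightarrow> nat \<Rightarrow> complex" where
  "fourier n s i j = unity_root n (s * (int i * int j)) / sqrt n"

text \<open>Note that this is the square of the norm.\<close>

definition frob :: "nat \<Rightarrow> (nat \<Rightarrow> nat \<Rightarrow> complex) \<Rightarrow> real" where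
  "frob n a = (\<Sum>i<n. \<Sum>j<n. (cmod (a i j))\<^sup>2)"

definition fmul :: "nat \<Rightarrow> (nat \<Rightarrow> nat \<Rightarrow> complex) \<Rightarrow> (nat \<Rightarrow> nat \<Rightarrow> complex) \<Rightarrow> nat \<Rightarrow> nat \<Rightarrow> complex" where
  "fmul n a b i j = (\<Sum>p<n. a i p * b p j)"

text \<open>The constant \<open>c\<close> bounds the square of the operator norm, in keeping with
  \<open>frob\<close>.\<close>

definition op_bound :: "nat \<Rightarrow> (nat \<Rightarrow> nat \<Rightarrow> complex) \<Rightarrow> real \<Rightarrow> bool" where
  "op_bound n a c \<longleftrightarrow> (\<forall>v. (\<Sum>i<n. (cmod (\<Sum>p<n. a i p * v p))\<^sup>2) \<le> c * (\<Sum>p<n. (cmod (v p))\<^sup>2))"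

lemma sum_int_lessThan: "(\<Sum>i\<in>{0..<int n}. F i) = (\<Sum>i<n. F (int i))"
  by (rule sum.reindex_bij_witness[of _ int nat]) auto

lemma frob_nonneg: "0 \<le> frob n a"
  by (auto simp: frob_def intro!: sum_nonneg)

lemma frob_cong:
  "(\<And>i j. i < n \<Longrightarrow> j < n \<Longrightarrow> cmod (a i j) = cmod (b i j)) \<Longrightarrow> frob n a = frob n b"
  by (simp add: frob_def)

lemma frob_mono:
  "(\<And>i j. i < n \<Longrightarrow> j < n \<Longrightarrow> cmod (a i j) \<le> cmod (b i j)) \<Longrightarrow> frob n a \<le> frob n b"
  unfolding frob_def by (intro sum_mono power_mono) auto

lemma frob_scale: "frob n (\<lambda>i j. c * a i j) = (cmod c)\<^sup>2 * frob n a"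
  by (simp add: frob_def norm_mult power_mult_distrib sum_distrib_left)

lemma cmod_add_squared_le: "(cmod (x + y))\<^sup>2 \<le> 2 * (cmod x)\<^sup>2 + 2 * (cmod y)\<^sup>2"
proof -
  have "(cmod (x + y))\<^sup>2 \<le> (cmod x + cmod y)\<^sup>2"
    by (intro power_mono norm_triangle_ineq) auto
  also have "\<dots> \<le> 2 * (cmod x)\<^sup>2 + 2 * (cmod y)\<^sup>2"
    using sum_squares_bound[of "cmod x" "cmod y"] by (simp add: power2_sum)
  finally show ?thesis .
qed

lemma frob_add: "frob n (\<lambda>i j. a i j + b i j) \<le> 2 * frob n a + 2 * frob n b"
proof -
  have "frob n (\<lambda>i j. a i j + b i j) \<le> (\<Sum>i<n. \<Sum>j<n. 2 * (cmod (a i j))\<^sup>2 + 2 * (cmod (b i j))\<^sup>2)"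
    unfolding frob_def by (intro sum_mono cmod_add_squared_le)
  also have "\<dots> = 2 * frob n a + 2 * frob n b"
    by (simp add: frob_def sum.distrib sum_distrib_left)
  finally show ?thesis .
qed

lemma frob_transpose: "frob n (\<lambda>i j. a j i) = frob n a"
  unfolding frob_def by (rule sum.swap)

lemma frob_fmul_left:
  assumes "op_bound n a c" shows "frob n (fmul n a b) \<le> c * frob n b"
proof -
  have "frob n (fmul n a b) = (\<Sum>j<n. \<Sum>i<n. (cmod (\<Sum>p<n. a i p * b p j))\<^sup>2)"
    unfolding frob_def fmul_def by (rule sum.swap)
  also have "\<dots> \<le> (\<Sum>j<n. c * (\<Sum>p<n. (cmod (b p j))\<^sup>2))"
  proof (rule sum_mono)
    fix j
    show "(\<Sum>i<n. (cmod (\<Sum>p<n. a i p * b p j))\<^sup>2) \<le> c * (\<Sum>p<n. (cmod (b p j))\<^sup>2)"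
      using assms[unfolded op_bound_def, rule_format, of "\<lambda>p. b p j"] .
  qed
  also have "\<dots> = c * frob n b"
    unfolding frob_def sum_distrib_left[symmetric] by (subst sum.swap) simp
  finally show ?thesis .
qed

lemma frob_fmul_right:
  assumes "op_bound n (\<lambda>i j. a j i) c" shows "frob n (fmul n b a) \<le> c * frob n b"
proof -
  have "frob n (fmul n b a) = frob n (fmul n (\<lambda>i j. a j i) (\<lambda>i j. b j i))"
    by (subst frob_transpose[symmetric]) (simp add: fmul_def[abs_def] mult.commute)
  also have "\<dots> \<le> c * frob n (\<lambda>i j. b j i)"
    by (rule frob_fmul_left[OF assms])
  finally show ?thesis using frob_transpose[of n b] by simp
qed

lemma op_bound_fourier:
  assumes n: "n > 0" and s: "\<bar>s\<bar> = 1"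
  shows "op_bound n (fourier n s) 1"
  unfolding op_bound_def
proof
  fix v
  have "(\<Sum>i<n. (cmod (\<Sum>p<n. fourier n s i p * v p))\<^sup>2)
      = (\<Sum>i<n. (cmod (\<Sum>p<n. v p * unity_root n (s * (int p * int i))))\<^sup>2 / n)"
  proof (rule sum.cong[OF refl])
    fix i
    have "(\<Sum>p<n. fourier n s i p * v p) = (\<Sum>p<n. v p * unity_root n (s * (int p * int i))) / sqrt n"
      by (simp add: fourier_def sum_divide_distrib mult_ac)
    then show "(cmod (\<Sum>p<n. fourier n s i p * v p))\<^sup>2
        = (cmod (\<Sum>p<n. v p * unity_root n (s * (int p * int i))))\<^sup>2 / n"
      by (simp add: norm_divide power_divide)
  qed
  also have "\<dots> = (\<Sum>p<n. (cmod (v p))\<^sup>2)"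
    using parseval[OF n s, of "\<lambda>p. v (nat p)"] n
    by (simp add: sum_int_lessThan sum_divide_distrib[symmetric])
  finally show "(\<Sum>i<n. (cmod (\<Sum>p<n. fourier n s i p * v p))\<^sup>2) \<le> 1 * (\<Sum>p<n. (cmod (v p))\<^sup>2)"
    by simp
qed

lemma frob_fourier:
  assumes n: "n > 0"
  shows "frob n (fmul n (fourier n 1) b) \<le> frob n b" "frob n (fmul n b (fourier n 1)) \<le> frob n b"
proof -
  have sym: "(\<lambda>i j. fourier n 1 j i) = fourier n 1"
    by (simp add: fourier_def fun_eq_iff mult.commute)
  show "frob n (fmul n (fourier n 1) b) \<le> frob n b" "frob n (fmul n b (fourier n 1)) \<le> frob n b"
    using frob_fmul_left[OF op_bound_fourier[OF n, of 1], of b]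
      frob_fmul_right[of n "fourier n 1" 1 b] op_bound_fourier[OF n, of 1]
    by (simp_all add: sym)
qed

lemma clock_chirp_fourier_gap_traceless:
  assumes n: "n > 0" and tr: "(\<Sum>i<n. b i i) = 0"
  shows "frob n b \<le> 9584 * (frob n (\<lambda>i j. (unity_root n i - unity_root n j) * b i j)
    + frob n (\<lambda>i j. (chirp n i - chirp n j) * b i j)
    + frob n (\<lambda>i j. fmul n (fourier n 1) b i j - fmul n b (fourier n 1) i j))"
proof -
  \<comment> \<open>The periodic extension to all integer indices, as required by the Weyl
    transform.\<close>
  define b' where "b' i j = b (nat (i mod int n)) (nat (j mod int n))" for i j
  have b': "b' (int i) (int j) = b i j" if "i < n" "j < n" for i j
    using that by (simp add: b'_def)
  have "frob n (\<lambda>i j. fmul n (fourier n 1) b i j - fmul n b (fourier n 1) i j)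
    = (\<Sum>i<n. \<Sum>j<n. (cmod (\<Sum>p<n. unity_root n (int i * int p) * b p j - b i p * unity_root n (int p * int j)))\<^sup>2 / n)"
    unfolding frob_def
  proof (intro sum.cong refl)
    fix i j
    have "fmul n (fourier n 1) b i j - fmul n b (fourier n 1) i j
        = (\<Sum>p<n. unity_root n (int i * int p) * b p j - b i p * unity_root n (int p * int j)) / sqrt n"
      by (simp add: fmul_def fourier_def sum_subtractf[symmetric] sum_divide_distrib diff_divide_distrib)
    then show "(cmod (fmul n (fourier n 1) b i j - fmul n b (fourier n 1) i j))\<^sup>2
      = (cmod (\<Sum>p<n. unity_root n (int i * int p) * b p j - b i p * unity_root n (int p * int j)))\<^sup>2 / n"
      by (simp add: norm_divide power_divide)
  qed
  then have F: "frob n (\<lambda>i j. fmul n (fourier n 1) b i j - fmul n b (fourier n 1) i j)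
    = (\<Sum>i<n. \<Sum>j<n. (cmod (\<Sum>p<n. unity_root n (int i * int p) * b p j - b i p * unity_root n (int p * int j)))\<^sup>2) / n"
    by (simp add: sum_divide_distrib)
  have "(\<Sum>i\<in>{0..<int n}. b' i i) = 0"
    using tr by (simp add: sum_int_lessThan b')
  moreover have "b' (i + int n) j = b' i j" "b' i (j + int n) = b' i j" for i j
    by (simp_all add: b'_def)
  ultimately have gap: "(\<Sum>i<n. \<Sum>j<n. (cmod (b' i j))\<^sup>2) \<le> 9584 *
      ((\<Sum>i<n. \<Sum>j<n. (cmod ((unity_root n i - unity_root n j) * b' i j))\<^sup>2)
       + (\<Sum>i<n. \<Sum>j<n. (cmod ((chirp n i - chirp n j) * b' i j))\<^sup>2)
       + (\<Sum>i<n. \<Sum>j<n. (cmod (\<Sum>p<n. unity_root n (int i * int p) * b' p j - b' i p * unity_root n (int p * int j)))\<^sup>2) / n)"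
    using weyl_clock_chirp_fourier_gap[of n b'] n unfolding sum_int_lessThan by blast
  have "(\<Sum>i<n. \<Sum>j<n. (cmod (b' i j))\<^sup>2) = frob n b"
    "(\<Sum>i<n. \<Sum>j<n. (cmod ((unity_root n i - unity_root n j) * b' i j))\<^sup>2)
      = frob n (\<lambda>i j. (unity_root n i - unity_root n j) * b i j)"
    "(\<Sum>i<n. \<Sum>j<n. (cmod ((chirp n i - chirp n j) * b' i j))\<^sup>2)
      = frob n (\<lambda>i j. (chirp n i - chirp n j) * b i j)"
    "(\<Sum>i<n. \<Sum>j<n. (cmod (\<Sum>p<n. unity_root n (int i * int p) * b' p j - b' i p * unity_root n (int p * int j)))\<^sup>2)
      = (\<Sum>i<n. \<Sum>j<n. (cmod (\<Sum>p<n. unity_root n (int i * int p) * b p j - b i p * unity_root n (int p * int j)))\<^sup>2)"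
    by (simp_all add: frob_def b')
  with gap show ?thesis unfolding F by (simp only:)
qed

text \<open>Subtracting the mean of the diagonal makes the matrix traceless and changes none of the
  commutators, because scalars commute with everything.\<close>

lemma clock_chirp_fourier_gap:
  assumes n: "n > 0"
  defines "t b \<equiv> (\<Sum>i<n. b i i) / of_nat n"
  shows "frob n (\<lambda>i j. b i j - (if i = j then t b else 0))
    \<le> 9584 * (frob n (\<lambda>i j. (unity_root n i - unity_root n j) * b i j)
    + frob n (\<lambda>i j. (chirp n i - chirp n j) * b i j)
    + frob n (\<lambda>i j. fmul n (fourier n 1) b i j - fmul n b (fourier n 1) i j))"
proof -
  define b0 where "b0 = (\<lambda>i j. b i j - (if i = j then t b else 0))"
  have "(\<Sum>i<n. b0 i i) = 0"
    using n by (simp add: b0_def t_def sum_subtractf)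
  note gap = clock_chirp_fourier_gap_traceless[of n b0, OF n this]
  have comm: "frob n (\<lambda>i j. (unity_root n i - unity_root n j) * b0 i j) = frob n (\<lambda>i j. (unity_root n i - unity_root n j) * b i j)"
    "frob n (\<lambda>i j. (chirp n i - chirp n j) * b0 i j) = frob n (\<lambda>i j. (chirp n i - chirp n j) * b i j)"
    by (rule frob_cong; simp add: b0_def)+
  have commF: "frob n (\<lambda>i j. fmul n (fourier n 1) b0 i j - fmul n b0 (fourier n 1) i j)
    = frob n (\<lambda>i j. fmul n (fourier n 1) b i j - fmul n b (fourier n 1) i j)"
  proof (rule frob_cong)
    fix i j assume ij: "i < n" "j < n"
    have "fmul n (fourier n 1) b0 i j = fmul n (fourier n 1) b i j - fourier n 1 i j * t b"
      using ij by (simp add: fmul_def b0_def right_diff_distrib sum_subtractf if_distrib[of "(*) _"] cong: if_cong)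
    moreover have "fmul n b0 (fourier n 1) i j = fmul n b (fourier n 1) i j - t b * fourier n 1 i j"
      using ij by (simp add: fmul_def b0_def left_diff_distrib sum_subtractf if_distrib[of "\<lambda>x. x * _"] cong: if_cong)
    ultimately show "cmod (fmul n (fourier n 1) b0 i j - fmul n b0 (fourier n 1) i j)
      = cmod (fmul n (fourier n 1) b i j - fmul n b (fourier n 1) i j)"
      by (simp add: mult.commute)
  qed
  show ?thesis using gap unfolding comm commF unfolding b0_def .
qed

section \<open>The block matrix\<close>

definition fcomm :: "nat \<Rightarrow> (nat \<Rightarrow> nat \<Rightarrow> complex) \<Rightarrow> (nat \<Rightarrow> nat \<Rightarrow> complex) \<Rightarrow> nat \<Rightarrow> nat \<Rightarrow> complex" where
  "fcomm n a b i j = fmul n a b i j - fmul n b a i j"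

text \<open>The factor \<open>\<i>\<close> makes the off-diagonal part skew-Hermitian, so that the Hermitian part is diagonal with
  separated blocks. The sign \<open>s = -1\<close> gives the transpose of \<open>s = 1\<close>.\<close>

definition expander_block :: "int \<Rightarrow> nat \<Rightarrow> nat \<Rightarrow> nat \<Rightarrow> nat \<Rightarrow> nat \<Rightarrow> complex" where
  "expander_block s n a c i j =
    (if a = c then if i = j then (if a = 0 then unity_root n i else if a = 1 then 4 + chirp n i else 8) else 0
     else if a = 0 \<and> c = 2 then \<i> * fourier n s i j
     else if a = 2 \<and> c = 0 then \<i> * fourier n (- s) i j
     else if i = j then \<i> else 0)"

definition expander :: "int \<Rightarrow> nat \<Rightarrow> nat \<Rightarrow> nat \<Rightarrow> complex" where
  "expander s n p q = expander_block s n (p div n) (q div n) (p mod n) (q mod n)"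

lemma frob_fcomm:
  assumes "op_bound n a c" "op_bound n (\<lambda>i j. a j i) c"
  shows "frob n (fcomm n a b) \<le> 4 * c * frob n b"
proof -
  have "frob n (fcomm n a b) = frob n (\<lambda>i j. fmul n a b i j + (- 1) * fmul n b a i j)"
    by (rule frob_cong) (simp add: fcomm_def)
  also have "\<dots> \<le> 2 * frob n (fmul n a b) + 2 * frob n (\<lambda>i j. (- 1) * fmul n b a i j)"
    by (rule frob_add)
  finally show ?thesis
    using frob_fmul_left[OF assms(1), of b] frob_fmul_right[OF assms(2), of b]
    unfolding frob_scale by simp
qed

lemma frob_diff: "frob n (\<lambda>i j. a i j - b i j) \<le> 2 * frob n a + 2 * frob n b"
  using frob_add[of n a "\<lambda>i j. (- 1) * b i j"] unfolding frob_scale by simp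

lemma sum_lessThan_add:
  fixes F :: "nat \<Rightarrow> 'a :: comm_monoid_add"
  shows "(\<Sum>p<a + b. F p) = (\<Sum>p<a. F p) + (\<Sum>i<b. F (a + i))"
  by (induction b) (auto simp: add.assoc)

lemma sum_lessThan_mult:
  fixes F :: "nat \<Rightarrow> 'a :: comm_monoid_add"
  shows "(\<Sum>p<m * n. F p) = (\<Sum>a<m. \<Sum>i<n. F (a * n + i))"
proof (induction m)
  case (Suc m)
  then show ?case using sum_lessThan_add[of F "m * n" n] by (simp add: add.commute)
qed simp

lemma sum_lessThan_3: "(\<Sum>a<3::nat. F a) = F 0 + F 1 + F 2"
  by (simp add: numeral_3_eq_3 numeral_2_eq_2)

lemma sum_lessThan_3n: "(\<Sum>p<3 * n. F p) = (\<Sum>a<3. \<Sum>i<n. F (a * n + i))" for n :: nat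
  by (rule sum_lessThan_mult)

lemma expander_block:
  assumes "i < n" "j < n" shows "expander s n (a * n + i) (c * n + j) = expander_block s n a c i j"
  using assms by (simp add: expander_def)

lemma expander_transpose: "expander s n q p = expander (- s) n p q"
proof -
  have "expander_block s n c a j i = expander_block (- s) n a c i j" for a c i j
    by (auto simp: expander_block_def fourier_def mult.commute)
  then show ?thesis by (simp only: expander_def)
qed

lemma cmod_add3_squared_le: "(cmod (x + y + z))\<^sup>2 \<le> 3 * (cmod x)\<^sup>2 + 3 * (cmod y)\<^sup>2 + 3 * (cmod z)\<^sup>2"
proof -
  have "(cmod (x + y + z))\<^sup>2 \<le> (cmod x + cmod y + cmod z)\<^sup>2"
    by (intro power_mono norm_triangle_le add_mono norm_triangle_ineq) auto
  also have "\<dots> \<le> 3 * (cmod x)\<^sup>2 + 3 * (cmod y)\<^sup>2 + 3 * (cmod z)\<^sup>2"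
    using sum_squares_bound[of "cmod x" "cmod y"] sum_squares_bound[of "cmod y" "cmod z"]
      sum_squares_bound[of "cmod x" "cmod z"]
    by (simp add: power2_eq_square algebra_simps)
  finally show ?thesis .
qed

text \<open>Each block row has three summands, so Cauchy-Schwarz with constant 3 applies. The
  weights collected by the three block components are 9, 81 and 198; the bound 225 is the square of
  15, the scale later divided out.\<close>

lemma op_bound_expander:
  assumes n: "n > 0" and s: "\<bar>s\<bar> = 1"
  shows "op_bound (3 * n) (expander s n) 225"
  unfolding op_bound_def
proof
  fix v :: "nat \<Rightarrow> complex"
  define w where "w c i = v (c * n + i)" for c i
  define N where "N c = (\<Sum>i<n. (cmod (w c i))\<^sup>2)" for c
  define \<Phi> where "\<Phi> t c i = (\<Sum>j<n. fourier n t i j * w c j)" for t c i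
  have \<Phi>: "(\<Sum>i<n. (cmod (\<Phi> t c i))\<^sup>2) \<le> N c" if "\<bar>t\<bar> = 1" for t c
    using op_bound_fourier[OF n that] unfolding op_bound_def \<Phi>_def N_def by simp
  define R where "R a i = (\<Sum>c<3. \<Sum>j<n. expander_block s n a c i j * w c j)" for a i
  have "(\<Sum>p<3 * n. (cmod (\<Sum>q<3 * n. expander s n p q * v q))\<^sup>2) = (\<Sum>a<3. \<Sum>i<n. (cmod (R a i))\<^sup>2)"
    unfolding sum_lessThan_3n R_def w_def by (intro sum.cong refl) (simp add: expander_block)
  moreover have "(\<Sum>i<n. (cmod (R 0 i))\<^sup>2) \<le> 3 * N 0 + 3 * N 1 + 3 * (\<Sum>i<n. (cmod (\<Phi> s 2 i))\<^sup>2)"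
    unfolding N_def sum_distrib_left sum.distrib[symmetric]
  proof (rule sum_mono)
    fix i assume "i \<in> {..<n}"
    then have "R 0 i = unity_root n i * w 0 i + \<i> * w 1 i + \<i> * \<Phi> s 2 i"
      by (simp add: R_def sum_lessThan_3 expander_block_def \<Phi>_def sum_distrib_left mult.assoc
        if_distrib[of "\<lambda>x. x * _"] cong: if_cong)
    then show "(cmod (R 0 i))\<^sup>2 \<le> 3 * (cmod (w 0 i))\<^sup>2 + 3 * (cmod (w 1 i))\<^sup>2 + 3 * (cmod (\<Phi> s 2 i))\<^sup>2"
      using cmod_add3_squared_le[of "unity_root n i * w 0 i" "\<i> * w 1 i" "\<i> * \<Phi> s 2 i"]
      by (simp add: norm_mult)
  qed
  moreover have "(\<Sum>i<n. (cmod (R 1 i))\<^sup>2) \<le> 3 * N 0 + 75 * N 1 + 3 * N 2"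
    unfolding N_def sum_distrib_left sum.distrib[symmetric]
  proof (rule sum_mono)
    fix i assume "i \<in> {..<n}"
    then have "R 1 i = \<i> * w 0 i + (4 + chirp n i) * w 1 i + \<i> * w 2 i"
      by (simp add: R_def sum_lessThan_3 expander_block_def if_distrib[of "\<lambda>x. x * _"] cong: if_cong)
    moreover have "cmod (4 + chirp n i) \<le> 5"
      using norm_triangle_ineq[of 4 "chirp n i"] by simp
    then have "(cmod (4 + chirp n i))\<^sup>2 \<le> 5\<^sup>2"
      by (intro power_mono) auto
    then have "(cmod ((4 + chirp n i) * w 1 i))\<^sup>2 \<le> 25 * (cmod (w 1 i))\<^sup>2"
      unfolding norm_mult power_mult_distrib by (intro mult_right_mono) auto
    ultimately show "(cmod (R 1 i))\<^sup>2 \<le> 3 * (cmod (w 0 i))\<^sup>2 + 75 * (cmod (w 1 i))\<^sup>2 + 3 * (cmod (w 2 i))\<^sup>2"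
      using cmod_add3_squared_le[of "\<i> * w 0 i" "(4 + chirp n i) * w 1 i" "\<i> * w 2 i"]
      by (simp add: norm_mult)
  qed
  moreover have "(\<Sum>i<n. (cmod (R 2 i))\<^sup>2) \<le> 3 * (\<Sum>i<n. (cmod (\<Phi> (- s) 0 i))\<^sup>2) + 3 * N 1 + 192 * N 2"
    unfolding N_def sum_distrib_left sum.distrib[symmetric]
  proof (rule sum_mono)
    fix i assume "i \<in> {..<n}"
    then have "R 2 i = \<i> * \<Phi> (- s) 0 i + \<i> * w 1 i + 8 * w 2 i"
      by (simp add: R_def sum_lessThan_3 expander_block_def \<Phi>_def sum_distrib_left mult.assoc
        if_distrib[of "\<lambda>x. x * _"] cong: if_cong)
    then show "(cmod (R 2 i))\<^sup>2 \<le> 3 * (cmod (\<Phi> (- s) 0 i))\<^sup>2 + 3 * (cmod (w 1 i))\<^sup>2 + 192 * (cmod (w 2 i))\<^sup>2"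
      using cmod_add3_squared_le[of "\<i> * \<Phi> (- s) 0 i" "\<i> * w 1 i" "8 * w 2 i"]
      by (simp add: norm_mult power_mult_distrib)
  qed
  moreover have "(\<Sum>p<3 * n. (cmod (v p))\<^sup>2) = N 0 + N 1 + N 2"
    unfolding sum_lessThan_3n sum_lessThan_3 N_def w_def ..
  moreover have "N 0 \<ge> 0" "N 1 \<ge> 0" "N 2 \<ge> 0" by (simp_all add: N_def sum_nonneg)
  moreover have "(\<Sum>i<n. (cmod (\<Phi> s 2 i))\<^sup>2) \<le> N 2" "(\<Sum>i<n. (cmod (\<Phi> (- s) 0 i))\<^sup>2) \<le> N 0"
    by (rule \<Phi>; use s in simp)+
  ultimately show "(\<Sum>p<3 * n. (cmod (\<Sum>q<3 * n. expander s n p q * v q))\<^sup>2) \<le> 225 * (\<Sum>p<3 * n. (cmod (v p))\<^sup>2)"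
    unfolding sum_lessThan_3 by linarith
qed

text \<open>Near-equality of the blocks transfers the relations with the chirp and the Fourier
  matrix to \<open>B 0\<close>, where the gap applies; the other blocks follow from their distance
  to \<open>B 0\<close>. The three commutators of \<open>B 0\<close> cost 1, 10 and 10 times
  \<open>E\<close>, and 21 times 9584 is 201264.\<close>

lemma diagonal_blocks_gap:
  fixes B :: "nat \<Rightarrow> nat \<Rightarrow> nat \<Rightarrow> complex"
  assumes n: "n > 0"
  defines "t \<equiv> (\<Sum>i<n. B 0 i i) / of_nat n"
  assumes z: "frob n (\<lambda>i j. (unity_root n i - unity_root n j) * B 0 i j) \<le> E"
    and d: "frob n (\<lambda>i j. (chirp n i - chirp n j) * B 1 i j) \<le> E"
    and B01: "frob n (\<lambda>i j. B 1 i j - B 0 i j) \<le> E"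
    and B12: "frob n (\<lambda>i j. B 2 i j - B 1 i j) \<le> E"
    and F: "frob n (\<lambda>i j. fmul n (fourier n 1) (B 2) i j - fmul n (B 0) (fourier n 1) i j) \<le> E"
  shows "(\<Sum>a<3. frob n (\<lambda>i j. B a i j - (if i = j then t else 0))) \<le> 1006330 * E"
proof -
  have B02: "frob n (\<lambda>i j. B 2 i j - B 0 i j) \<le> 4 * E"
    using frob_add[of n "\<lambda>i j. B 2 i j - B 1 i j" "\<lambda>i j. B 1 i j - B 0 i j"] B01 B12 by simp
  have "frob n (\<lambda>i j. (chirp n i - chirp n j) * (B 1 i j - B 0 i j)) \<le> 4 * E"
  proof -
    have "frob n (\<lambda>i j. (chirp n i - chirp n j) * (B 1 i j - B 0 i j)) \<le> frob n (\<lambda>i j. 2 * (B 1 i j - B 0 i j))"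
    proof (rule frob_mono)
      fix i j
      show "cmod ((chirp n i - chirp n j) * (B 1 i j - B 0 i j)) \<le> cmod (2 * (B 1 i j - B 0 i j))"
        using norm_triangle_ineq4[of "chirp n i" "chirp n j"]
        unfolding norm_mult by (intro mult_right_mono) auto
    qed
    then show ?thesis using B01 unfolding frob_scale by simp
  qed
  then have d0: "frob n (\<lambda>i j. (chirp n i - chirp n j) * B 0 i j) \<le> 10 * E"
    using d frob_diff[of n "\<lambda>i j. (chirp n i - chirp n j) * B 1 i j"
      "\<lambda>i j. (chirp n i - chirp n j) * (B 1 i j - B 0 i j)"]
    by (simp add: algebra_simps)
  have "frob n (fmul n (fourier n 1) (\<lambda>i j. B 2 i j - B 0 i j)) \<le> 4 * E"
    using frob_fourier(1)[OF n, of "\<lambda>i j. B 2 i j - B 0 i j"] B02 by simp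
  moreover have "frob n (\<lambda>i j. fmul n (fourier n 1) (B 0) i j - fmul n (B 0) (fourier n 1) i j)
    = frob n (\<lambda>i j. (fmul n (fourier n 1) (B 2) i j - fmul n (B 0) (fourier n 1) i j)
      - fmul n (fourier n 1) (\<lambda>i j. B 2 i j - B 0 i j) i j)"
    by (rule frob_cong) (simp add: fmul_def right_diff_distrib sum_subtractf)
  ultimately have F0: "frob n (\<lambda>i j. fmul n (fourier n 1) (B 0) i j - fmul n (B 0) (fourier n 1) i j) \<le> 10 * E"
    using F frob_diff[of n "\<lambda>i j. fmul n (fourier n 1) (B 2) i j - fmul n (B 0) (fourier n 1) i j"
      "fmul n (fourier n 1) (\<lambda>i j. B 2 i j - B 0 i j)"] by simp
  have 0: "frob n (\<lambda>i j. B 0 i j - (if i = j then t else 0)) \<le> 201264 * E"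
    using clock_chirp_fourier_gap[OF n, of "B 0"] z d0 F0 unfolding t_def by simp
  have 1: "frob n (\<lambda>i j. B 1 i j - (if i = j then t else 0)) \<le> 402530 * E"
    using frob_add[of n "\<lambda>i j. B 0 i j - (if i = j then t else 0)" "\<lambda>i j. B 1 i j - B 0 i j"] 0 B01
    by simp
  have 2: "frob n (\<lambda>i j. B 2 i j - (if i = j then t else 0)) \<le> 402536 * E"
    using frob_add[of n "\<lambda>i j. B 0 i j - (if i = j then t else 0)" "\<lambda>i j. B 2 i j - B 0 i j"] 0 B02
    by simp
  show ?thesis unfolding sum_lessThan_3 using 0 1 2 by simp
qed

section \<open>Diagonal Hermitian part and decay of off-diagonal blocks\<close>

lemma expander_block_add_cnj:
  assumes "a < 3" "c < 3"
  shows "expander_block 1 n a c i j + cnj (expander_block 1 n c a j i)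
    = (if a = c \<and> i = j then of_real (2 * Re (expander_block 1 n a a i i)) else 0)"
proof -
  have "cnj (fourier n (- s) i j) = fourier n s j i" for s i j
    by (simp add: fourier_def cnj_unity_root mult.commute)
  from this[of 1] this[of "-1"] show ?thesis
    using assms by (auto simp: expander_block_def complex_add_cnj)
qed

text \<open>The real parts in the three blocks lie in [-1, 1], in [3, 5] and at 8.\<close>

lemma Re_expander_block_separated:
  assumes "a < 3" "c < 3" "a \<noteq> c"
  shows "2 \<le> \<bar>Re (expander_block 1 n a a i i) - Re (expander_block 1 n c c j j)\<bar>"
proof -
  have "\<bar>Re (unity_root n k)\<bar> \<le> 1" "\<bar>Re (chirp n k)\<bar> \<le> 1" for k
    using abs_Re_le_cmod[of "unity_root n k"] abs_Re_le_cmod[of "chirp n k"] by simp_all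
  from this(1)[of "int i"] this(1)[of "int j"] this(2)[of "int i"] this(2)[of "int j"]
  have R: "\<bar>Re (unity_root n i)\<bar> \<le> 1" "\<bar>Re (unity_root n j)\<bar> \<le> 1"
    "\<bar>Re (chirp n i)\<bar> \<le> 1" "\<bar>Re (chirp n j)\<bar> \<le> 1" by auto
  have "a = 0 \<or> a = 1 \<or> a = 2" "c = 0 \<or> c = 1 \<or> c = 2" using assms by auto
  then show ?thesis
    by (elim disjE) (use assms(3) R in \<open>simp_all add: expander_block_def\<close>)
qed

text \<open>For Hermitian \<open>B\<close> the commutator minus its adjoint is the commutator with
  twice the Hermitian part of the block matrix. That part is diagonal, so each entry of
  \<open>B\<close> is multiplied by a difference of diagonal values, of modulus at least 4 between
  distinct blocks.\<close>

lemma off_diagonal_blocks_bound: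
  assumes n: "n > 0" and herm: "\<And>p q. p < 3 * n \<Longrightarrow> q < 3 * n \<Longrightarrow> B q p = cnj (B p q)"
  shows "4 * frob (3 * n) (\<lambda>p q. if p div n = q div n then 0 else B p q)
    \<le> frob (3 * n) (fcomm (3 * n) (expander 1 n) B)"
proof -
  let ?m = "3 * n"
  define X where "X = expander 1 n"
  define C where "C = fcomm ?m X B"
  define h where "h p = Re (X p p)" for p
  have X: "X p r + cnj (X r p) = (if p = r then of_real (2 * h p) else 0)" if "p < ?m" "r < ?m" for p r
  proof -
    have "p div n < 3" "r div n < 3" using that n by (simp_all add: less_mult_imp_div_less mult.commute)
    moreover have "p div n = r div n \<and> p mod n = r mod n \<longleftrightarrow> p = r"
      by (metis div_mult_mod_eq)
    ultimately show ?thesis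
      unfolding X_def h_def expander_def by (subst expander_block_add_cnj) auto
  qed
  \<comment> \<open>For Hermitian \<open>B\<close> this is an entry of the commutator of \<open>B\<close> with \<open>X + X\<^sup>*\<close>, which is diagonal.\<close>
  have CX: "C p q - cnj (C q p) = 2 * of_real (h p - h q) * B p q" if pq: "p < ?m" "q < ?m" for p q
  proof -
    have "C p q - cnj (C q p)
        = (\<Sum>r<?m. (X p r + cnj (X r p)) * B r q) - (\<Sum>r<?m. B p r * (X r q + cnj (X q r)))"
    proof -
      have cnjB: "cnj (B r p) = B p r" if "p < ?m" "r < ?m" for p r
        using herm[OF that(2,1)] by simp
      have "cnj (C q p) = (\<Sum>r<?m. B p r * cnj (X q r)) - (\<Sum>r<?m. cnj (X r p) * B r q)"
        using pq by (simp add: C_def fcomm_def fmul_def cnjB mult.commute)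
      then show ?thesis
        by (simp add: C_def fcomm_def fmul_def sum.distrib ring_distribs)
    qed
    also have "(\<Sum>r<?m. (X p r + cnj (X r p)) * B r q) = (\<Sum>r<?m. if p = r then of_real (2 * h p) * B r q else 0)"
      using pq by (intro sum.cong refl) (simp add: X)
    also have "(\<Sum>r<?m. B p r * (X r q + cnj (X q r))) = (\<Sum>r<?m. if r = q then B p r * of_real (2 * h q) else 0)"
      using pq by (intro sum.cong refl) (auto simp: X)
    finally show ?thesis using pq by (simp add: algebra_simps)
  qed
  have "8 * (cmod (if p div n = q div n then 0 else B p q))\<^sup>2 \<le> (cmod (C p q))\<^sup>2 + (cmod (C q p))\<^sup>2"
    if pq: "p < ?m" "q < ?m" for p q
  proof (cases "p div n = q div n")
    case False
    have "p div n < 3" "q div n < 3" using pq n by (simp_all add: less_mult_imp_div_less mult.commute)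
    from Re_expander_block_separated[OF this False] have "2 \<le> \<bar>h p - h q\<bar>"
      by (simp add: h_def X_def expander_def)
    then have "4 * cmod (B p q) \<le> 2 * \<bar>h p - h q\<bar> * cmod (B p q)"
      by (intro mult_right_mono) auto
    also have "\<dots> = cmod (C p q - cnj (C q p))"
      unfolding CX[OF pq] norm_mult norm_of_real by simp
    finally have "(4 * cmod (B p q))\<^sup>2 \<le> (cmod (C p q - cnj (C q p)))\<^sup>2"
      by (intro power_mono) auto
    also have "\<dots> \<le> 2 * (cmod (C p q))\<^sup>2 + 2 * (cmod (C q p))\<^sup>2"
      using cmod_add_squared_le[of "C p q" "- cnj (C q p)"] by simp
    finally show ?thesis using False by simp
  qed simp
  then have "(\<Sum>p<?m. \<Sum>q<?m. 8 * (cmod (if p div n = q div n then 0 else B p q))\<^sup>2)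
      \<le> (\<Sum>p<?m. \<Sum>q<?m. (cmod (C p q))\<^sup>2 + (cmod (C q p))\<^sup>2)"
    by (intro sum_mono) auto
  also have "\<dots> = frob ?m C + frob ?m (\<lambda>p q. C q p)"
    by (simp only: frob_def sum.distrib)
  finally have "8 * frob ?m (\<lambda>p q. if p div n = q div n then 0 else B p q) \<le> frob ?m C + frob ?m C"
    unfolding frob_transpose[of ?m C] by (simp add: frob_def sum_distrib_left)
  then show ?thesis by (simp add: C_def X_def)
qed

section \<open>The block-diagonal part and the commutator gap\<close>

lemma frob_blocks:
  "frob (3 * n) G = (\<Sum>a<3. \<Sum>c<3. frob n (\<lambda>i j. G (a * n + i) (c * n + j)))"
  unfolding frob_def sum_lessThan_3n by (rule sum.cong[OF refl], rule sum.swap)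

lemma frob_block_le:
  assumes "a < 3" "c < 3"
  shows "frob n (\<lambda>i j. G (a * n + i) (c * n + j)) \<le> frob (3 * n) G"
proof -
  have "frob n (\<lambda>i j. G (a * n + i) (c * n + j)) \<le> (\<Sum>c<3. frob n (\<lambda>i j. G (a * n + i) (c * n + j)))"
    using assms by (intro member_le_sum frob_nonneg) auto
  also have "\<dots> \<le> (\<Sum>a<3. \<Sum>c<3. frob n (\<lambda>i j. G (a * n + i) (c * n + j)))"
    using assms by (intro member_le_sum[of a "{..<3}" "\<lambda>a. \<Sum>c<3. frob n (\<lambda>i j. G (a * n + i) (c * n + j))"] sum_nonneg frob_nonneg) auto
  finally show ?thesis by (simp only: frob_blocks)
qed

text \<open>For a block-diagonal argument only one summand of each block product survives, so every
  block of the commutator is an intertwining defect between two diagonal blocks.\<close>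

lemma commutator_block_diagonal:
  fixes B :: "nat \<Rightarrow> nat \<Rightarrow> complex"
  assumes "a < 3" "c < 3" "i < n" "j < n"
  defines "D \<equiv> \<lambda>p q. if p div n = q div n then B p q else 0"
  shows "fcomm (3 * n) (expander s n) D (a * n + i) (c * n + j)
    = fmul n (expander_block s n a c) (\<lambda>i j. B (c * n + i) (c * n + j)) i j
      - fmul n (\<lambda>i j. B (a * n + i) (a * n + j)) (expander_block s n a c) i j"
proof -
  have "fmul (3 * n) (expander s n) D (a * n + i) (c * n + j)
      = (\<Sum>e<3. if e = c then fmul n (expander_block s n a c) (\<lambda>i j. B (c * n + i) (c * n + j)) i j else 0)"
    unfolding fmul_def sum_lessThan_3n using assms(1-4)
    by (intro sum.cong refl) (auto simp: expander_block D_def)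
  moreover have "fmul (3 * n) D (expander s n) (a * n + i) (c * n + j)
      = (\<Sum>e<3. if e = a then fmul n (\<lambda>i j. B (a * n + i) (a * n + j)) (expander_block s n a c) i j else 0)"
    unfolding fmul_def sum_lessThan_3n using assms(1-4)
    by (intro sum.cong refl) (auto simp: expander_block D_def)
  ultimately show ?thesis
    using assms(1,2) by (simp add: fcomm_def)
qed

lemma hermitian_commutator_gap:
  assumes n: "n > 0" and herm: "\<And>p q. p < 3 * n \<Longrightarrow> q < 3 * n \<Longrightarrow> B q p = cnj (B p q)"
  obtains t where "frob (3 * n) (\<lambda>p q. B p q - (if p = q then t else 0))
    \<le> 500000000 * frob (3 * n) (fcomm (3 * n) (expander 1 n) B)"
proof -
  let ?m = "3 * n"
  define X where "X = expander 1 n"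
  define E where "E = frob ?m (fcomm ?m X B)"
  define O1 where "O1 = (\<lambda>p q. if p div n = q div n then 0 else B p q)"
  define D where "D = (\<lambda>p q. if p div n = q div n then B p q else 0)"
  define b where "b a i j = B (a * n + i) (a * n + j)" for a i j
  \<comment> \<open>The mean of the diagonal of the first block, as in
    \<open>diagonal_blocks_gap\<close>; it need not be the normalized trace of
    \<open>B\<close>.\<close>
  define t where "t = (\<Sum>i<n. b 0 i i) / of_nat n"
  have E0: "E \<ge> 0" unfolding E_def by (rule frob_nonneg)
  have O1: "4 * frob ?m O1 \<le> E"
    using off_diagonal_blocks_bound[of n B, OF n herm] unfolding O1_def E_def X_def by simp
  have "fcomm ?m X D p q = fcomm ?m X B p q - fcomm ?m X O1 p q" for p q
  proof -
    have "B p q = D p q + O1 p q" for p q by (simp add: D_def O1_def)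
    then show ?thesis by (simp add: fcomm_def fmul_def sum.distrib ring_distribs)
  qed
  then have "frob ?m (fcomm ?m X D) = frob ?m (\<lambda>p q. fcomm ?m X B p q - fcomm ?m X O1 p q)"
    by (intro frob_cong) simp
  then have "frob ?m (fcomm ?m X D) \<le> 2 * E + 2 * frob ?m (fcomm ?m X O1)"
    unfolding E_def using frob_diff[of ?m "fcomm ?m X B" "fcomm ?m X O1"] by simp
  moreover have "op_bound ?m (\<lambda>i j. X j i) 225"
    using op_bound_expander[OF n, of "-1"] unfolding X_def by (simp add: expander_transpose[of 1])
  then have "frob ?m (fcomm ?m X O1) \<le> 4 * 225 * frob ?m O1"
    using op_bound_expander[OF n, of 1] unfolding X_def by (intro frob_fcomm) auto
  \<comment> \<open>The constant is 2 + 2 * 900 / 4: the off-diagonal part has mass at most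
    \<open>E / 4\<close>, and its commutator at most 900 times that.\<close>
  ultimately have CD: "frob ?m (fcomm ?m X D) \<le> 452 * E" using O1 by simp
  have blk: "frob n (\<lambda>i j. fmul n (expander_block 1 n a c) (b c) i j - fmul n (b a) (expander_block 1 n a c) i j) \<le> 452 * E"
    if "a < 3" "c < 3" for a c
  proof -
    have "frob n (\<lambda>i j. fmul n (expander_block 1 n a c) (b c) i j - fmul n (b a) (expander_block 1 n a c) i j)
        = frob n (\<lambda>i j. fcomm ?m X D (a * n + i) (c * n + j))"
      using that unfolding X_def D_def b_def[abs_def]
      by (intro frob_cong) (simp add: commutator_block_diagonal)
    also have "\<dots> \<le> 452 * E"
      using frob_block_le[OF that, of n "fcomm ?m X D"] CD by simp
    finally show ?thesis .
  qed
  \<comment> \<open>The diagonal blocks of the block matrix are themselves diagonal; the additive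
    constants 4 and 8 cancel in the differences.\<close>
  have diag: "fmul n (expander_block 1 n a a) (b a) i j - fmul n (b a) (expander_block 1 n a a) i j
      = (expander_block 1 n a a i i - expander_block 1 n a a j j) * b a i j" if "i < n" "j < n" for a i j
    using that by (simp add: fmul_def expander_block_def if_distrib[of "\<lambda>x. x * _"] if_distrib[of "(*) _"] algebra_simps cong: if_cong)
  \<comment> \<open>Every off-diagonal block that meets the middle index is a multiple of the
    identity, so its defect compares two diagonal blocks directly.\<close>
  have off: "fmul n (expander_block 1 n a c) (b c) i j - fmul n (b a) (expander_block 1 n a c) i j = \<i> * (b c i j - b a i j)"
    if "i < n" "j < n" "a \<noteq> c" "a = 1 \<or> c = 1" for a c i j
    using that by (auto simp: fmul_def expander_block_def if_distrib[of "\<lambda>x. x * _"] if_distrib[of "(*) _"] algebra_simps cong: if_cong)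
  have gap: "(\<Sum>a<3. frob n (\<lambda>i j. b a i j - (if i = j then t else 0))) \<le> 1006330 * (452 * E)"
    unfolding t_def
  proof (rule diagonal_blocks_gap[OF n])
    have "frob n (\<lambda>i j. (unity_root n i - unity_root n j) * b 0 i j)
      = frob n (\<lambda>i j. fmul n (expander_block 1 n 0 0) (b 0) i j - fmul n (b 0) (expander_block 1 n 0 0) i j)"
      by (intro frob_cong) (simp add: diag, simp add: expander_block_def)
    then show "frob n (\<lambda>i j. (unity_root n i - unity_root n j) * b 0 i j) \<le> 452 * E"
      using blk[of 0 0] by simp
    have "frob n (\<lambda>i j. (chirp n i - chirp n j) * b 1 i j)
      = frob n (\<lambda>i j. fmul n (expander_block 1 n 1 1) (b 1) i j - fmul n (b 1) (expander_block 1 n 1 1) i j)"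
      by (intro frob_cong) (simp only: diag, simp add: expander_block_def)
    then show "frob n (\<lambda>i j. (chirp n i - chirp n j) * b 1 i j) \<le> 452 * E"
      using blk[of 1 1] by simp
    have "frob n (\<lambda>i j. b 1 i j - b 0 i j)
      = frob n (\<lambda>i j. fmul n (expander_block 1 n 0 1) (b 1) i j - fmul n (b 0) (expander_block 1 n 0 1) i j)"
      by (intro frob_cong, subst off) (simp_all add: norm_mult)
    then show "frob n (\<lambda>i j. b 1 i j - b 0 i j) \<le> 452 * E"
      using blk[of 0 1] by simp
    have "frob n (\<lambda>i j. b 2 i j - b 1 i j)
      = frob n (\<lambda>i j. fmul n (expander_block 1 n 1 2) (b 2) i j - fmul n (b 1) (expander_block 1 n 1 2) i j)"
      by (intro frob_cong, subst off) (simp_all add: norm_mult)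
    then show "frob n (\<lambda>i j. b 2 i j - b 1 i j) \<le> 452 * E"
      using blk[of 1 2] by simp
    have "fmul n (expander_block 1 n 0 2) (b 2) i j - fmul n (b 0) (expander_block 1 n 0 2) i j
      = \<i> * (fmul n (fourier n 1) (b 2) i j - fmul n (b 0) (fourier n 1) i j)" for i j
      by (simp add: fmul_def expander_block_def right_diff_distrib sum_distrib_left mult_ac)
    then have "frob n (\<lambda>i j. fmul n (fourier n 1) (b 2) i j - fmul n (b 0) (fourier n 1) i j)
      = frob n (\<lambda>i j. fmul n (expander_block 1 n 0 2) (b 2) i j - fmul n (b 0) (expander_block 1 n 0 2) i j)"
      by (intro frob_cong) (simp add: norm_mult)
    then show "frob n (\<lambda>i j. fmul n (fourier n 1) (b 2) i j - fmul n (b 0) (fourier n 1) i j) \<le> 452 * E"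
      using blk[of 0 2] by simp
  qed
  have "frob ?m (\<lambda>p q. B p q - (if p = q then t else 0))
      = frob ?m O1 + frob ?m (\<lambda>p q. if p div n = q div n then B p q - (if p = q then t else 0) else 0)"
    unfolding frob_def sum.distrib[symmetric] by (intro sum.cong refl) (auto simp: O1_def)
  also have "frob ?m (\<lambda>p q. if p div n = q div n then B p q - (if p = q then t else 0) else 0)
      = (\<Sum>a<3. \<Sum>c<3. if c = a then frob n (\<lambda>i j. b a i j - (if i = j then t else 0)) else 0)"
    unfolding frob_blocks by (intro sum.cong refl) (auto simp: b_def frob_def intro!: sum.cong)
  also have "\<dots> = (\<Sum>a<3. frob n (\<lambda>i j. b a i j - (if i = j then t else 0)))"
    by simp
  finally have "frob ?m (\<lambda>p q. B p q - (if p = q then t else 0)) \<le> E + 1006330 * (452 * E)"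
    using gap O1 E0 by linarith
  also have "\<dots> \<le> 500000000 * E" using E0 by simp
  finally show ?thesis using that unfolding E_def X_def by blast
qed

section \<open>Transfer to matrices\<close>

text \<open>The mean minimises the sum of squared distances, in the real and imaginary parts
  separately. This lets the normalized trace replace the scalar supplied by
  \<open>hermitian_commutator_gap\<close>.\<close>

lemma sum_norm_minus_mean_le:
  fixes x :: "'a \<Rightarrow> complex"
  assumes "finite A" "A \<noteq> {}"
  shows "(\<Sum>i\<in>A. (cmod (x i - (\<Sum>i\<in>A. x i) / of_nat (card A)))\<^sup>2) \<le> (\<Sum>i\<in>A. (cmod (x i - t))\<^sup>2)"
proof -
  have real: "(\<Sum>i\<in>A. (y i - (\<Sum>i\<in>A. y i) / card A)\<^sup>2) \<le> (\<Sum>i\<in>A. (y i - s)\<^sup>2)" for y :: "'a \<Rightarrow> real" and s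
  proof -
    define m where "m = (\<Sum>i\<in>A. y i) / card A"
    have S: "(\<Sum>i\<in>A. y i) = card A * m" using assms by (simp add: m_def)
    have "(\<Sum>i\<in>A. (y i - s)\<^sup>2) = (\<Sum>i\<in>A. (y i - m)\<^sup>2 + 2 * (m - s) * (y i - m) + (m - s)\<^sup>2)"
      by (intro sum.cong refl) (simp add: power2_eq_square algebra_simps)
    also have "\<dots> = (\<Sum>i\<in>A. (y i - m)\<^sup>2) + card A * (m - s)\<^sup>2"
      by (simp add: sum.distrib sum_distrib_left[symmetric] sum_subtractf S)
    finally show ?thesis by (simp add: m_def)
  qed
  show ?thesis
    using add_mono[OF real[of "\<lambda>i. Re (x i)" "Re t"] real[of "\<lambda>i. Im (x i)" "Im t"]]
    by (simp add: cmod_power2 sum.distrib)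
qed

lemma hs_norm_eq_frob:
  assumes "A \<in> carrier_mat m m"
  shows "hs_norm A = sqrt (frob m (\<lambda>i j. A $$ (i, j)))"
  unfolding hs_norm_eq[OF assms] frob_def by (subst sum.swap) (rule refl)

lemma l2_norm_eq:
  assumes "v \<in> carrier_vec m"
  shows "l2_norm v = sqrt (\<Sum>i<m. (cmod (v $ i))\<^sup>2)"
proof -
  have "v \<bullet>c v = of_real (\<Sum>i<m. (cmod (v $ i))\<^sup>2)"
    using assms by (simp add: scalar_prod_def lessThan_atLeast0 complex_norm_square del: of_real_power)
  then show ?thesis by (simp add: l2_norm_def)
qed

lemma contraction_mat:
  assumes "op_bound m a c" "c \<le> 1"
  shows "contraction (mat m m (\<lambda>(i, j). a i j))"
proof -
  let ?A = "mat m m (\<lambda>(i, j). a i j)"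
  have "l2_norm (?A *\<^sub>v v) \<le> 1" if v: "v \<in> carrier_vec m" and 1: "l2_norm v \<le> 1" for v
  proof -
    have c: "?A *\<^sub>v v \<in> carrier_vec m"
      using v by (intro mult_mat_vec_carrier[of _ m m]) auto
    have "(\<Sum>i<m. (cmod ((?A *\<^sub>v v) $ i))\<^sup>2) = (\<Sum>i<m. (cmod (\<Sum>p<m. a i p * v $ p))\<^sup>2)"
      using v by (intro sum.cong refl) (simp add: scalar_prod_def lessThan_atLeast0)
    also have "\<dots> \<le> c * (\<Sum>p<m. (cmod (v $ p))\<^sup>2)"
      using assms(1)[unfolded op_bound_def, rule_format, of "\<lambda>p. v $ p"] .
    also have "\<dots> \<le> 1 * (\<Sum>p<m. (cmod (v $ p))\<^sup>2)"
      using assms(2) by (intro mult_right_mono) (auto simp: sum_nonneg)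
    also have "\<dots> \<le> 1"
      using 1 unfolding l2_norm_eq[OF v] by simp
    finally show ?thesis
      unfolding l2_norm_eq[OF c] by (simp only: real_sqrt_le_1_iff)
  qed
  \<comment> \<open>The zero vector shows that the supremum in \<open>op_norm\<close> is over a
    nonempty set, as \<open>cSUP_least\<close> demands.\<close>
  moreover have "l2_norm (0\<^sub>v m) \<le> 1" using l2_norm_eq[of "0\<^sub>v m" m] by simp
  then have "{v \<in> carrier_vec m. l2_norm v \<le> 1} \<noteq> {}"
    by (auto intro: exI[of _ "0\<^sub>v m"])
  ultimately show ?thesis
    unfolding contraction_def op_norm_def by (intro cSUP_least) auto
qed

lemma malnormal_expander:
  assumes n: "n > 0"
  shows "malnormal (1 / 400000) (mat (3 * n) (3 * n) (\<lambda>(p, q). expander 1 n p q / 15))"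
proof -
  let ?m = "3 * n"
  let ?X = "mat ?m ?m (\<lambda>(p, q). expander 1 n p q / 15)"
  have "1 / 400000 * hs_norm (B - normalized_trace B \<cdot>\<^sub>m 1\<^sub>m ?m) \<le> hs_norm (commutator ?X B)"
    if B: "B \<in> carrier_mat ?m ?m" and sa: "self_adjoint B" for B
  proof -
    define f where "f p q = B $$ (p, q)" for p q
    have herm: "f q p = cnj (f p q)" if "p < ?m" "q < ?m" for p q
      using mat_adjoint_index[OF B that(2,1)] sa by (simp add: self_adjoint_def f_def)
    then obtain t where t: "frob ?m (\<lambda>p q. f p q - (if p = q then t else 0))
        \<le> 500000000 * frob ?m (fcomm ?m (expander 1 n) f)"
      using hermitian_commutator_gap[OF n, of f] by blast
    define \<tau> where "\<tau> = normalized_trace B"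
    have \<tau>: "\<tau> = (\<Sum>p<?m. f p p) / of_nat (card {..<?m})"
      using B by (simp add: \<tau>_def normalized_trace_def mat_trace_def f_def)
    \<comment> \<open>Only the diagonal depends on the scalar \<open>s\<close>, so minimising over
      \<open>s\<close> is a question about the diagonal alone.\<close>
    have split: "frob ?m (\<lambda>p q. f p q - (if p = q then s else 0))
        = (\<Sum>p<?m. \<Sum>q<?m. if p = q then 0 else (cmod (f p q))\<^sup>2) + (\<Sum>p<?m. (cmod (f p p - s))\<^sup>2)" for s
    proof -
      have "frob ?m (\<lambda>p q. f p q - (if p = q then s else 0))
        = (\<Sum>p<?m. \<Sum>q<?m. (if p = q then 0 else (cmod (f p q))\<^sup>2) + (if p = q then (cmod (f p p - s))\<^sup>2 else 0))"
        unfolding frob_def by (intro sum.cong refl) auto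
      then show ?thesis by (simp add: sum.distrib)
    qed
    have "frob ?m (\<lambda>p q. f p q - (if p = q then \<tau> else 0)) \<le> frob ?m (\<lambda>p q. f p q - (if p = q then t else 0))"
      unfolding split \<tau> by (intro add_left_mono sum_norm_minus_mean_le) (use n in \<open>auto simp: lessThan_empty_iff\<close>)
    with t have le: "frob ?m (\<lambda>p q. f p q - (if p = q then \<tau> else 0)) \<le> 500000000 * frob ?m (fcomm ?m (expander 1 n) f)"
      by linarith
    have c1: "B - \<tau> \<cdot>\<^sub>m 1\<^sub>m ?m \<in> carrier_mat ?m ?m" using B by auto
    have h1: "hs_norm (B - \<tau> \<cdot>\<^sub>m 1\<^sub>m ?m) = sqrt (frob ?m (\<lambda>p q. f p q - (if p = q then \<tau> else 0)))"
      unfolding hs_norm_eq_frob[OF c1] using B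
      by (intro arg_cong[of _ _ sqrt] frob_cong) (simp add: f_def)
    have c2: "commutator ?X B \<in> carrier_mat ?m ?m" using B by (auto simp: commutator_def)
    have "frob ?m (\<lambda>p q. commutator ?X B $$ (p, q)) = frob ?m (\<lambda>p q. (1 / 15) * fcomm ?m (expander 1 n) f p q)"
      using B by (intro frob_cong arg_cong[of _ _ cmod])
        (simp add: commutator_def fcomm_def fmul_def f_def scalar_prod_def lessThan_atLeast0
          diff_divide_distrib sum_divide_distrib)
    then have h2: "hs_norm (commutator ?X B) = sqrt (frob ?m (fcomm ?m (expander 1 n) f) / 225)"
      unfolding hs_norm_eq_frob[OF c2] frob_scale by (simp add: power_divide)
    \<comment> \<open>The scaling by 1/15 divides the squared commutator norm by 225, and the square
      of 400000 exceeds 225 times 500000000.\<close>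
    have "1 / 400000 * hs_norm (B - \<tau> \<cdot>\<^sub>m 1\<^sub>m ?m)
        = sqrt (frob ?m (\<lambda>p q. f p q - (if p = q then \<tau> else 0)) / 400000\<^sup>2)"
      unfolding h1 by (simp add: real_sqrt_divide)
    also have "\<dots> \<le> hs_norm (commutator ?X B)"
      unfolding h2 using le frob_nonneg[of ?m "fcomm ?m (expander 1 n) f"] by (intro real_sqrt_le_mono) simp
    finally show ?thesis unfolding \<tau>_def .
  qed
  then show ?thesis unfolding malnormal_def by simp
qed

theorem proposition3p2:
  shows "\<exists>c::real. c > 0 \<and>
    (\<exists>N::nat. \<forall>n\<ge>N. \<exists>X. X \<in> carrier_mat (3 * n) (3 * n) \<and> contraction X \<and> mal X \<ge> c)"
proof (intro exI[of _ "1 / 400000"] conjI exI[of _ 1] allI impI)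
  fix n :: nat assume "1 \<le> n"
  \<comment> \<open>Dimension at least 2 guarantees that the greatest malnormality constant exists,
    so that \<open>mal\<close> dominates every admissible one.\<close>
  then have n: "n > 0" "3 * n \<ge> 2" by auto
  define X where "X = mat (3 * n) (3 * n) (\<lambda>(p, q). expander 1 n p q / 15)"
  have X: "X \<in> carrier_mat (3 * n) (3 * n)" by (simp add: X_def)
  have "op_bound (3 * n) (\<lambda>p q. expander 1 n p q / 15) 1"
    using op_bound_expander[OF n(1), of 1]
    by (simp add: op_bound_def sum_divide_distrib[symmetric] norm_divide power_divide mult.commute)
  then have "contraction X" unfolding X_def by (intro contraction_mat) auto
  moreover have "1 / 400000 \<le> mal X"
    by (rule malnormal_mal(2)[OF X n(2)]) (simp add: X_def malnormal_expander[OF n(1)])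
  ultimately show "\<exists>X. X \<in> carrier_mat (3 * n) (3 * n) \<and> contraction X \<and> 1 / 400000 \<le> mal X"
    using X by blast
qed simp

end
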